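(* Let $\hat\mu=C^\top\rho_0+\overline C^\top\hat\eta$ and consider the problem $$\max_{\lambda_0,\dots,\lambda_T\in\mathbb{R}^k}\ \sum_{t=0}^T\lambda_t^\top\rho_t-\hat\mu^\top\operatorname{diag}(u_0)A_0\operatorname{diag}(u_1)A_1\cdots\operatorname{diag}(u_{T-1})A_{T-1}u_T,\qquad u_t:=\exp(C^\top\lambda_t).\qquad(\mathrm{D}')$$ Define $\hat\phi_0:=\hat\mu$, $\phi_T:=\mathbf 1$, and recursively $$\hat\phi_{t+1}=A_t^\top(\hat\phi_t\odot u_t),\quad t=0,\dots,T-1,\qquad \phi_t=A_t(u_{t+1}\odot\phi_{t+1}),\quad t=T-1,\dots,0.$$ Then block coordinate ascent applied to $(\mathrm{D}')$ (maximizing over one block $\lambda_t$ at a time with the remaining blocks fixed) updates $u_t$ according to $$Cu_t=\rho_t\oslash C(\phi_t\odot\hat\phi_t),\qquad \overline C u_t=\mathbf 1,\qquad t=0,\dots,T.$$ These updates are summarized in the algorithm given in the context, and the resulting iterates converge to a maximizer of $(\mathrm{D}')$.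
   Context: Setting. Let $n,T\ge1$ be integers and let $A_0,\dots,A_{T-1}\in\mathbb{R}^{n\times n}_{\ge0}$ be row-stochastic matrices ($A_t\mathbf 1=\mathbf 1$). Let $\pi=\{\pi_1,\dots,\pi_k\}\subseteq\{1,\dots,n\}$ have $k$ elements, let $C=[e_{\pi_1},\dots,e_{\pi_k}]^\top\in\{0,1\}^{k\times n}$ be the coordinate-selection matrix of $\pi$, and let $\overline C\in\{0,1\}^{(n-k)\times n}$ be the coordinate-selection matrix of $\{1,\dots,n\}\setminus\pi$. Let $\rho_0,\dots,\rho_T\in\mathbb{R}^k$ (observed masses) and $\hat\eta\in\mathbb{R}^{n-k}_{\ge0}$ be given. $\mathbf 1$ is the all-ones vector; $\odot$, $\oslash$, $\exp$ are entrywise multiplication, division and exponential. Algorithm: initialize $\hat\phi_0\leftarrow\hat\mu$, $\phi_T\leftarrow\mathbf 1$, and $u_t>0$ for $t=0,\dots,T$; compute $\phi_t\leftarrow A_t(u_{t+1}\odot\phi_{t+1})$ for $t=T-1,\dots,0$. Then repeat (in practice until the residual in the observation constraints is below a tolerance): for $t=0,\dots,T$ in order, set $u_t\leftarrow C^\top(\rho_t\oslash C(\phi_t\odot\hat\phi_t))+\overline C^\top\overline C\mathbf 1$ and, if $t<T$, $\hat\phi_{t+1}\leftarrow A_t^\top(\hat\phi_t\odot u_t)$; afterwards, for $t=T-1,\dots,0$, set $\phi_t\leftarrow A_t(u_{t+1}\odot\phi_{t+1})$. The variables $u_t$ and $\lambda_t$ are related by $u_t=\exp(C^\top\lambda_t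)$.
   Formalization: It is assumed that the observed masses ρ_t are entrywise nonnegative, that the entries of C(φ_t⊙φ̂_t) dividing ρ_t are nonzero, and, for the convergence claim, that (D') has a maximizer; without these the claim can fail or the update is undefined. *)

theory Defs
  imports Complex_Main "HOL-Library.FuncSet" "Jordan_Normal_Form.Matrix"
begin

(* Vectors and matrices carry their dimensions as natural numbers, so that k = 0 and k = n
   (no or only observed coordinates) are covered. Coordinates are numbered 0, ..., n - 1. *)

definition ones :: "nat \<Rightarrow> real vec" where
  "ones n = vec n (\<lambda>_. 1)"

definition vec_times :: "real vec \<Rightarrow> real vec \<Rightarrow> real vec" (infixl "\<odot>\<^sub>v" 70) where
  "x \<odot>\<^sub>v y = vec (dim_vec x) (\<lambda>i. x $ i * y $ i)"

definition vec_divide :: "real vec \<Rightarrow> real vec \<Rightarrow> real vec" (infixl "\<oslash>\<^sub>v" 70) where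
  "x \<oslash>\<^sub>v y = vec (dim_vec x) (\<lambda>i. x $ i / y $ i)"

definition diag_of :: "real vec \<Rightarrow> real mat" where
  "diag_of x = mat_diag (dim_vec x) (\<lambda>i. x $ i)"

definition row_stochastic :: "nat \<Rightarrow> real mat \<Rightarrow> bool" where
  "row_stochastic n A \<longleftrightarrow> A \<in> carrier_mat n n \<and> 0\<^sub>m n n \<le> A \<and> A *\<^sub>v ones n = ones n"

definition selection_mat :: "nat \<Rightarrow> nat list \<Rightarrow> real mat" where
  "selection_mat n is = mat_of_rows n (map (unit_vec n) is)"

(* Families (lam_0, ..., lam_T) of vectors in R^k; extensional, so that equality of families
   is equality of the T + 1 blocks. *)
definition multipliers :: "nat \<Rightarrow> nat \<Rightarrow> (nat \<Rightarrow> real vec) set" where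
  "multipliers T k = {..T} \<rightarrow>\<^sub>E carrier_vec k"

definition scaling :: "real mat \<Rightarrow> (nat \<Rightarrow> real vec) \<Rightarrow> nat \<Rightarrow> real vec" where
  "scaling C lam t = map_vec exp (transpose_mat C *\<^sub>v lam t)"

(* diag(u_0) A_0 diag(u_1) A_1 ... diag(u_{t-1}) A_{t-1} *)
primrec scaled_product ::
  "nat \<Rightarrow> (nat \<Rightarrow> real mat) \<Rightarrow> (nat \<Rightarrow> real vec) \<Rightarrow> nat \<Rightarrow> real mat" where
  "scaled_product n A u 0 = 1\<^sub>m n"
| "scaled_product n A u (Suc t) = scaled_product n A u t * diag_of (u t) * A t"

definition dual_objective ::
  "nat \<Rightarrow> (nat \<Rightarrow> real mat) \<Rightarrow> real mat \<Rightarrow> real vec \<Rightarrow> (nat \<Rightarrow> real vec) \<Rightarrow> (nat \<Rightarrow> real vec) \<Rightarrow> real"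
  where
  "dual_objective T A C \<mu> \<rho> lam =
     (\<Sum>t\<le>T. lam t \<bullet> \<rho> t)
     - \<mu> \<bullet> (scaled_product (dim_col C) A (scaling C lam) T *\<^sub>v scaling C lam T)"

definition dual_maximizer ::
  "nat \<Rightarrow> (nat \<Rightarrow> real mat) \<Rightarrow> real mat \<Rightarrow> real vec \<Rightarrow> (nat \<Rightarrow> real vec) \<Rightarrow> (nat \<Rightarrow> real vec) \<Rightarrow> bool"
  where
  "dual_maximizer T A C \<mu> \<rho> lam \<longleftrightarrow>
     is_arg_max (dual_objective T A C \<mu> \<rho>) (\<lambda>l. l \<in> multipliers T (dim_row C)) lam"

primrec phi_hat ::
  "(nat \<Rightarrow> real mat) \<Rightarrow> real vec \<Rightarrow> (nat \<Rightarrow> real vec) \<Rightarrow> nat \<Rightarrow> real vec" where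
  "phi_hat A \<mu> u 0 = \<mu>"
| "phi_hat A \<mu> u (Suc t) = transpose_mat (A t) *\<^sub>v (phi_hat A \<mu> u t \<odot>\<^sub>v u t)"

function phi ::
  "nat \<Rightarrow> nat \<Rightarrow> (nat \<Rightarrow> real mat) \<Rightarrow> (nat \<Rightarrow> real vec) \<Rightarrow> nat \<Rightarrow> real vec" where
  "phi n T A u t =
     (if t < T then A t *\<^sub>v (u (Suc t) \<odot>\<^sub>v phi n T A u (Suc t)) else ones n)"
  by pat_completeness auto
termination by (relation "measure (\<lambda>(n, T, A, u, t). T - t)") auto

declare phi.simps [simp del]

(* The point x maximizes block t, the other blocks being those of lam. *)
definition block_maximizer ::
  "nat \<Rightarrow> (nat \<Rightarrow> real mat) \<Rightarrow> real mat \<Rightarrow> real vec \<Rightarrow> (nat \<Rightarrow> real vec)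
   \<Rightarrow> (nat \<Rightarrow> real vec) \<Rightarrow> nat \<Rightarrow> real vec \<Rightarrow> bool" where
  "block_maximizer T A C \<mu> \<rho> lam t x \<longleftrightarrow>
     is_arg_max (\<lambda>y. dual_objective T A C \<mu> \<rho> (lam(t := y))) (\<lambda>y. y \<in> carrier_vec (dim_row C)) x"

(* Cyclic block coordinate ascent: L N is the family after N block maximizations, taken in
   the order 0, ..., T, 0, ..., T, ...; hence L (m * Suc T) is the family after m sweeps. *)
definition block_coordinate_ascent ::
  "nat \<Rightarrow> (nat \<Rightarrow> real mat) \<Rightarrow> real mat \<Rightarrow> real vec \<Rightarrow> (nat \<Rightarrow> real vec)
   \<Rightarrow> (nat \<Rightarrow> nat \<Rightarrow> real vec) \<Rightarrow> bool" where
  "block_coordinate_ascent T A C \<mu> \<rho> L \<longleftrightarrow>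
     L 0 \<in> multipliers T (dim_row C) \<and>
     (\<forall>N. \<exists>x. block_maximizer T A C \<mu> \<rho> (L N) (N mod Suc T) x \<and>
              L (Suc N) = (L N)(N mod Suc T := x))"

definition multipliers_converge ::
  "nat \<Rightarrow> nat \<Rightarrow> (nat \<Rightarrow> nat \<Rightarrow> real vec) \<Rightarrow> (nat \<Rightarrow> real vec) \<Rightarrow> bool" where
  "multipliers_converge T k L lam \<longleftrightarrow>
     (\<forall>t\<le>T. \<forall>j<k. (\<lambda>N. L N t $ j) \<longlonglongrightarrow> lam t $ j)"

(* Program state of the algorithm: the arrays u, phi_hat, phi. *)
type_synonym alg_state = "(nat \<Rightarrow> real vec) \<times> (nat \<Rightarrow> real vec) \<times> (nat \<Rightarrow> real vec)"

fun forward_step ::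
  "nat \<Rightarrow> (nat \<Rightarrow> real mat) \<Rightarrow> real mat \<Rightarrow> real mat \<Rightarrow> (nat \<Rightarrow> real vec) \<Rightarrow> nat \<Rightarrow> alg_state \<Rightarrow> alg_state"
  where
  "forward_step T A C Cbar \<rho> t (u, fh, f) =
     (let v = transpose_mat C *\<^sub>v (\<rho> t \<oslash>\<^sub>v (C *\<^sub>v (f t \<odot>\<^sub>v fh t)))
              + transpose_mat Cbar *\<^sub>v (Cbar *\<^sub>v ones (dim_col C))
      in (u(t := v),
          if t < T then fh(Suc t := transpose_mat (A t) *\<^sub>v (fh t \<odot>\<^sub>v v)) else fh,
          f))"

fun backward_step :: "(nat \<Rightarrow> real mat) \<Rightarrow> nat \<Rightarrow> alg_state \<Rightarrow> alg_state" where
  "backward_step A t (u, fh, f) = (u, fh, f(t := A t *\<^sub>v (u (Suc t) \<odot>\<^sub>v f (Suc t))))"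

definition forward_pass ::
  "nat \<Rightarrow> (nat \<Rightarrow> real mat) \<Rightarrow> real mat \<Rightarrow> real mat \<Rightarrow> (nat \<Rightarrow> real vec) \<Rightarrow> alg_state \<Rightarrow> alg_state"
  where
  "forward_pass T A C Cbar \<rho> = fold (forward_step T A C Cbar \<rho>) [0..<Suc T]"

definition backward_pass :: "nat \<Rightarrow> (nat \<Rightarrow> real mat) \<Rightarrow> alg_state \<Rightarrow> alg_state" where
  "backward_pass T A = fold (backward_step A) (rev [0..<T])"

(* The algorithm only prescribes the initial values of phi_hat at 0 and of phi at T; the other
   entries of these arrays are overwritten before they are read. *)
definition alg_init ::
  "nat \<Rightarrow> (nat \<Rightarrow> real mat) \<Rightarrow> real mat \<Rightarrow> real vec \<Rightarrow> (nat \<Rightarrow> real vec) \<Rightarrow> alg_state" where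
  "alg_init T A C \<mu> u = backward_pass T A (u, \<lambda>_. \<mu>, \<lambda>_. ones (dim_col C))"

(* The array u after m sweeps, started from u0. *)
definition alg_u ::
  "nat \<Rightarrow> (nat \<Rightarrow> real mat) \<Rightarrow> real mat \<Rightarrow> real mat \<Rightarrow> real vec \<Rightarrow> (nat \<Rightarrow> real vec)
   \<Rightarrow> (nat \<Rightarrow> real vec) \<Rightarrow> nat \<Rightarrow> nat \<Rightarrow> real vec" where
  "alg_u T A C Cbar \<mu> \<rho> u0 m =
     fst (((backward_pass T A \<circ> forward_pass T A C Cbar \<rho>) ^^ m) (alg_init T A C \<mu> u0))"

end

theory Submission
  imports Defs
begin

text \<open>
  The dual objective is \<open>\<langle>\<lambda>, \<rho>\<rangle>\<close> minus a sum over paths \<open>(p\<^sub>0, \<dots>, p\<^sub>T)\<close> of the masses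
  \<open>w\<^sub>p exp \<langle>a\<^sub>p, \<lambda>\<rangle>\<close>, where \<open>a\<^sub>p\<close> marks the observed states that \<open>p\<close> visits. In one block it
  separates into the functions \<open>\<lambda>\<rho> - c exp \<lambda>\<close>, whose stationary point is the update, with
  \<open>c\<close> the product of the forward and the backward message.
  If a maximizer exists, the suboptimality is the relative entropy of the maximizing path measure with
  respect to the current one. Hence it stays bounded and bounds all \<open>\<langle>a\<^sub>p, \<lambda>\<rangle>\<close>, although
  \<open>\<lambda>\<close> itself is only determined up to the directions that all \<open>a\<^sub>p\<close> annihilate. On this bounded
  region a block step gains at least a multiple of the squared change of every \<open>\<langle>a\<^sub>p, \<lambda>\<rangle>\<close>,
  so one sweep gains at least a multiple of the squared gradient, and the latter dominates the
  suboptimality. The suboptimality therefore decays geometrically, the step lengths, bounded by its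
  square root, are summable, and the multipliers themselves converge.
\<close>

subsection \<open>Bounds for linear maps, the exponential and summable steps\<close>

lemma exp_gap_nonneg: "0 \<le> exp x - 1 - x" for x :: real
  using exp_ge_add_one_self[of x] by linarith

text \<open>For negative \<open>x\<close> positivity of the exponential suffices, otherwise the
  quadratic Taylor bound does. This growth turns an entropy bound into a bound on the
  exponents.\<close>

lemma abs_le_exp_gap: "\<bar>x\<bar> \<le> (exp x - 1 - x) + 1" for x :: real
proof (cases "0 \<le> x")
  case True
  have "0 \<le> (x - 1)\<^sup>2 + 1" by simp
  hence "2 * x \<le> 1 + x + x\<^sup>2 / 2" by (simp add: power2_eq_square algebra_simps)
  thus ?thesis using exp_lower_Taylor_quadratic[OF True] True by simp
qed (use exp_gt_zero[of x] in linarith)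

text \<open>Lagrange form of the Taylor remainder: the intermediate point \<open>t\<close> satisfies
  \<open>\<bar>t\<bar> \<le> M\<close>, so the second derivative there is at least
  \<open>exp (- M)\<close>.\<close>

lemma exp_gap_ge_square:
  fixes x :: real
  assumes "\<bar>x\<bar> \<le> M"
  shows "exp (- M) / 2 * x\<^sup>2 \<le> exp x - 1 - x"
proof -
  obtain t where t: "\<bar>t\<bar> \<le> \<bar>x\<bar>" "exp x = (\<Sum>m<2. x ^ m / fact m) + exp t / fact 2 * x ^ 2"
    using Maclaurin_exp_le[of x 2] by blast
  have "exp x - 1 - x = exp t / 2 * x\<^sup>2"
    using t(2) by (simp add: numeral_2_eq_2)
  moreover have "exp (- M) \<le> exp t" using t(1) assms by simp
  ultimately show ?thesis by (simp add: mult_right_mono)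
qed

lemma exp_diff_le:
  fixes x y :: real
  assumes "\<bar>x\<bar> \<le> M" "\<bar>y\<bar> \<le> M"
  shows "\<bar>exp x - exp y\<bar> \<le> exp M * \<bar>x - y\<bar>"
proof -
  have *: "exp v - exp u \<le> exp M * (v - u)" if "u \<le> v" "v \<le> M" for u v :: real
  proof -
    have "exp v - exp u = exp v * (1 - exp (u - v))"
      by (simp add: algebra_simps flip: exp_add)
    also have "\<dots> \<le> exp v * (v - u)"
      using exp_ge_add_one_self[of "u - v"] by (intro mult_left_mono; linarith?) simp
    also have "\<dots> \<le> exp M * (v - u)" using that by (intro mult_right_mono) auto
    finally show ?thesis .
  qed
  show ?thesis
    using *[of x y] *[of y x] assms by (cases "x \<le> y") auto
qed

text \<open>A linear map between finite-dimensional spaces has a section of bounded norm over its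
  image. The functionals are added one at a time; one that is independent of the earlier ones is met
  by a correction in their common kernel.\<close>

lemma linear_section_bounded:
  fixes a :: "'p \<Rightarrow> 'i \<Rightarrow> real"
  assumes "finite S" "finite I"
  shows "\<exists>K\<ge>0. \<forall>x. \<exists>y. (\<forall>p\<in>S. (\<Sum>i\<in>I. a p i * y i) = (\<Sum>i\<in>I. a p i * x i)) \<and>
           (\<Sum>i\<in>I. \<bar>y i\<bar>) \<le> K * (\<Sum>p\<in>S. \<bar>\<Sum>i\<in>I. a p i * x i\<bar>)"
  using assms(1)
proof (induction S)
  case empty
  show ?case by (intro exI[of _ 0] conjI order.refl allI exI[of _ "\<lambda>_. 0"]) simp_all
next
  case (insert q S)
  define f where "f p x = (\<Sum>i\<in>I. a p i * x i)" for p and x :: "'i \<Rightarrow> real"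
  have f_diff: "f p (\<lambda>i. x i - y i) = f p x - f p y" for p x y
    by (simp add: f_def algebra_simps sum_subtractf)
  have f_add: "f p (\<lambda>i. x i + c * y i) = f p x + c * f p y" for p x y c
    by (simp add: f_def algebra_simps sum.distrib sum_distrib_left)
  obtain K where K: "K \<ge> 0"
    and y: "\<And>x. \<exists>y. (\<forall>p\<in>S. f p y = f p x) \<and> (\<Sum>i\<in>I. \<bar>y i\<bar>) \<le> K * (\<Sum>p\<in>S. \<bar>f p x\<bar>)"
    using insert.IH unfolding f_def by blast
  show ?case
  proof (cases "\<exists>z. (\<forall>p\<in>S. f p z = 0) \<and> f q z \<noteq> 0")
    \<comment> \<open>The new functional vanishes on the common kernel of those in \<open>S\<close>,
      so it has the same value at \<open>x\<close> and at every \<open>y\<close> that agrees with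
      \<open>x\<close> on \<open>S\<close>.\<close>
    case False
    have "\<exists>y. (\<forall>p\<in>insert q S. f p y = f p x) \<and> (\<Sum>i\<in>I. \<bar>y i\<bar>) \<le> K * (\<Sum>p\<in>insert q S. \<bar>f p x\<bar>)" for x
    proof -
      obtain y where y: "\<forall>p\<in>S. f p y = f p x" "(\<Sum>i\<in>I. \<bar>y i\<bar>) \<le> K * (\<Sum>p\<in>S. \<bar>f p x\<bar>)"
        using y by blast
      have "\<forall>p\<in>S. f p (\<lambda>i. x i - y i) = 0" using y(1) by (simp add: f_diff)
      hence "f q (\<lambda>i. x i - y i) = 0" using False by blast
      moreover have "K * (\<Sum>p\<in>S. \<bar>f p x\<bar>) \<le> K * (\<Sum>p\<in>insert q S. \<bar>f p x\<bar>)"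
        using K insert by (intro mult_left_mono) auto
      ultimately show ?thesis using y f_diff[of q x y] by (intro exI[of _ y]) auto
    qed
    thus ?thesis using K unfolding f_def by blast
  next
    case True
    then obtain z where z: "\<forall>p\<in>S. f p z = 0" "f q z \<noteq> 0" by blast
    \<comment> \<open>\<open>Z\<close> is the size of \<open>z\<close> after rescaling its value at
      \<open>q\<close> to absolute value one, and \<open>R\<close> bounds the functional at
      \<open>q\<close>.\<close>
    define Z where "Z = (\<Sum>i\<in>I. \<bar>z i\<bar>) / \<bar>f q z\<bar>"
    define R where "R = (\<Sum>i\<in>I. \<bar>a q i\<bar>)"
    have Z: "Z \<ge> 0" "R \<ge> 0" by (auto simp: Z_def R_def intro: sum_nonneg)
    have "\<exists>y. (\<forall>p\<in>insert q S. f p y = f p x) \<and>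
        (\<Sum>i\<in>I. \<bar>y i\<bar>) \<le> (K + Z + R * K * Z) * (\<Sum>p\<in>insert q S. \<bar>f p x\<bar>)" for x
    proof -
      obtain y where y: "\<forall>p\<in>S. f p y = f p x" "(\<Sum>i\<in>I. \<bar>y i\<bar>) \<le> K * (\<Sum>p\<in>S. \<bar>f p x\<bar>)"
        using y by blast
      define N where "N = (\<Sum>p\<in>insert q S. \<bar>f p x\<bar>)"
      have N: "N = \<bar>f q x\<bar> + (\<Sum>p\<in>S. \<bar>f p x\<bar>)" using insert by (simp add: N_def)
      have N0: "0 \<le> (\<Sum>p\<in>S. \<bar>f p x\<bar>)" by (simp add: sum_nonneg)
      \<comment> \<open>Moving along \<open>z\<close> repairs the value at \<open>q\<close> and
        keeps the values on \<open>S\<close>.\<close>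
      define c where "c = (f q x - f q y) / f q z"
      have yN: "(\<Sum>i\<in>I. \<bar>y i\<bar>) \<le> K * N"
        using y(2) K N by (smt (verit, ccfv_threshold) mult_left_mono)
      have "\<bar>f q y\<bar> \<le> (\<Sum>i\<in>I. \<bar>a q i\<bar> * \<bar>y i\<bar>)"
        unfolding f_def by (rule order_trans[OF sum_abs]) (simp add: abs_mult)
      also have "\<dots> \<le> (\<Sum>i\<in>I. \<bar>a q i\<bar> * (\<Sum>i\<in>I. \<bar>y i\<bar>))"
        using assms(2) by (intro sum_mono mult_left_mono member_le_sum) auto
      also have "\<dots> = R * (\<Sum>i\<in>I. \<bar>y i\<bar>)" by (simp add: R_def sum_distrib_right)
      also have "\<dots> \<le> R * (K * N)" using yN Z by (intro mult_left_mono) auto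
      finally have fy: "\<bar>f q y\<bar> \<le> R * K * N" by simp
      have "\<bar>c\<bar> * (\<Sum>i\<in>I. \<bar>z i\<bar>) = \<bar>f q x - f q y\<bar> * Z" by (simp add: c_def Z_def)
      also have "\<dots> \<le> (N + R * K * N) * Z"
        using Z abs_triangle_ineq4[of "f q x" "f q y"] fy N N0 by (intro mult_right_mono; linarith)
      finally have cz: "\<bar>c\<bar> * (\<Sum>i\<in>I. \<bar>z i\<bar>) \<le> (N + R * K * N) * Z" .
      have "(\<Sum>i\<in>I. \<bar>y i + c * z i\<bar>) \<le> (\<Sum>i\<in>I. \<bar>y i\<bar> + \<bar>c\<bar> * \<bar>z i\<bar>)"
        by (intro sum_mono) (metis abs_mult abs_triangle_ineq)
      also have "\<dots> = (\<Sum>i\<in>I. \<bar>y i\<bar>) + \<bar>c\<bar> * (\<Sum>i\<in>I. \<bar>z i\<bar>)"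
        by (simp add: sum.distrib sum_distrib_left)
      also have "\<dots> \<le> K * N + (N + R * K * N) * Z" using yN cz by simp
      finally have "(\<Sum>i\<in>I. \<bar>y i + c * z i\<bar>) \<le> (K + Z + R * K * Z) * N"
        by (simp add: algebra_simps)
      moreover have "f q (\<lambda>i. y i + c * z i) = f q x" using z by (simp only: f_add c_def) simp
      ultimately show ?thesis using y z
        by (intro exI[of _ "\<lambda>i. y i + c * z i"]) (auto simp: f_add N_def)
    qed
    moreover have "0 \<le> K + Z + R * K * Z" using K Z by simp
    ultimately show ?thesis unfolding f_def by blast
  qed
qed

text \<open>A partial sum is at most its first \<open>K\<close> terms plus \<open>r\<close> times
  itself, which bounds all partial sums by one constant.\<close>

lemma summable_if_window_contraction:
  fixes z :: "nat \<Rightarrow> real"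
  assumes nonneg: "\<And>N. 0 \<le> z N" and "0 \<le> r" "r < 1"
    and contr: "\<And>N. z (N + K) \<le> r * z N"
  shows "summable z"
proof (rule summableI_nonneg_bounded[OF nonneg])
  fix n
  have "sum z {..<n} \<le> sum z {..<n + K}" using nonneg by (intro sum_mono2) auto
  also have "{..<n + K} = {..<K} \<union> {K..<n + K}" by auto
  also have "sum z \<dots> = sum z {..<K} + sum z {K..<n + K}" by (rule sum.union_disjoint) auto
  also have "sum z {K..<n + K} = (\<Sum>N<n. z (N + K))"
    using sum.shift_bounds_nat_ivl[of z 0 K n] by (simp add: atLeast0LessThan)
  also have "\<dots> \<le> r * sum z {..<n}"
    unfolding sum_distrib_left by (intro sum_mono contr)
  finally have "(1 - r) * sum z {..<n} \<le> sum z {..<K}" by (simp add: algebra_simps)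
  thus "sum z {..<n} \<le> sum z {..<K} / (1 - r)" using assms(3) by (simp add: field_simps)
qed

lemma convergent_if_summable_steps:
  fixes x :: "nat \<Rightarrow> real"
  assumes "summable z" and "\<And>N. \<bar>x (Suc N) - x N\<bar> \<le> C * z N"
  shows "convergent x"
proof -
  have "summable (\<lambda>N. x (Suc N) - x N)"
    using assms(2) by (intro summable_comparison_test'[OF summable_mult[OF assms(1), of C], of 0]) auto
  hence "convergent (\<lambda>n. \<Sum>N<n. x (Suc N) - x N)" by (simp only: summable_iff_convergent)
  thus ?thesis by (simp only: sum_lessThan_telescope convergent_diff_const_right_iff)
qed

subsection \<open>Geometric decay under cyclic block scaling\<close>

text \<open>
  Here \<open>P\<close> is the path measure at a maximizer \<open>x\<^sub>*\<close>, \<open>P p * exp (tilt N p)\<close> the one after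
  \<open>N\<close> block steps, and \<open>gap N\<close> their relative entropy, which is the suboptimality of step \<open>N\<close>.
\<close>

locale cyclic_scaling =
  fixes S :: "'p set" and I :: "'i set" and a :: "'p \<Rightarrow> 'i \<Rightarrow> real" and P :: "'p \<Rightarrow> real"
    and B :: "nat \<Rightarrow> 'i set" and K :: nat and x :: "nat \<Rightarrow> 'i \<Rightarrow> real" and xs :: "'i \<Rightarrow> real"
  assumes fin: "finite S" "finite I"
    and P_pos: "p \<in> S \<Longrightarrow> 0 < P p"
    and block_subset: "B N \<subseteq> I"
    and block_single: "p \<in> S \<Longrightarrow> i \<in> B N \<Longrightarrow> i' \<in> B N \<Longrightarrow> a p i \<noteq> 0 \<Longrightarrow> a p i' \<noteq> 0 \<Longrightarrow> i = i'"
    and a_le: "p \<in> S \<Longrightarrow> i \<in> I \<Longrightarrow> \<bar>a p i\<bar> \<le> 1"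
    and covered: "i \<in> I \<Longrightarrow> \<exists>p\<in>S. a p i = 1"
    and window: "i \<in> I \<Longrightarrow> \<exists>r<K. i \<in> B (N + r)"
    and unchanged: "i \<in> I \<Longrightarrow> i \<notin> B N \<Longrightarrow> x (Suc N) i = x N i"
    and marginal: "i \<in> B N \<Longrightarrow>
      (\<Sum>p\<in>S. a p i * (P p * exp (\<Sum>i\<in>I. a p i * (x (Suc N) i - xs i)))) = (\<Sum>p\<in>S. a p i * P p)"
begin

section \<open>Relative entropy along the iteration\<close>

definition tilt :: "nat \<Rightarrow> 'p \<Rightarrow> real" where
  "tilt N p = (\<Sum>i\<in>I. a p i * (x N i - xs i))"

definition gap :: "nat \<Rightarrow> real" where
  "gap N = (\<Sum>p\<in>S. P p * (exp (tilt N p) - 1 - tilt N p))"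

text \<open>The partial derivatives of \<open>- gap\<close>: the marginals of \<open>P\<close> minus
  those of the current measure.\<close>

definition gradient :: "nat \<Rightarrow> 'i \<Rightarrow> real" where
  "gradient N i = (\<Sum>p\<in>S. a p i * (P p * (1 - exp (tilt N p))))"

lemma gradient_block: "i \<in> B N \<Longrightarrow> gradient (Suc N) i = 0"
  using marginal[of i N] by (simp add: gradient_def tilt_def sum_subtractf right_diff_distrib)

lemma gap_nonneg: "0 \<le> gap N"
  unfolding gap_def using P_pos exp_gap_nonneg by (intro sum_nonneg mult_nonneg_nonneg) (auto simp: less_imp_le)

lemma tilt_step: "tilt N p - tilt (Suc N) p = (\<Sum>i\<in>B N. a p i * (x N i - x (Suc N) i))"
proof -
  have "tilt N p - tilt (Suc N) p = (\<Sum>i\<in>I. a p i * (x N i - x (Suc N) i))"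
    by (simp add: tilt_def sum_subtractf[symmetric] algebra_simps)
  also have "\<dots> = (\<Sum>i\<in>B N. a p i * (x N i - x (Suc N) i))"
    using block_subset[of N] fin unchanged[of _ N] by (intro sum.mono_neutral_right) auto
  finally show ?thesis .
qed

text \<open>Three-point identity for the Bregman divergence of exp: the first-order term is
  \<open>gradient (Suc N)\<close> paired with the step, and it vanishes because the step moves only
  coordinates in \<open>B N\<close>, where that gradient is zero.\<close>

lemma gap_decrease:
  "gap N - gap (Suc N) =
     (\<Sum>p\<in>S. P p * exp (tilt (Suc N) p) * (exp (tilt N p - tilt (Suc N) p) - 1 - (tilt N p - tilt (Suc N) p)))"
proof -
  have "(\<Sum>p\<in>S. P p * (1 - exp (tilt (Suc N) p)) * (tilt N p - tilt (Suc N) p)) =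
      (\<Sum>p\<in>S. \<Sum>i\<in>B N. a p i * (P p * (1 - exp (tilt (Suc N) p))) * (x N i - x (Suc N) i))"
    by (simp add: tilt_step sum_distrib_left mult_ac)
  also have "\<dots> = (\<Sum>i\<in>B N. gradient (Suc N) i * (x N i - x (Suc N) i))"
    unfolding gradient_def sum_distrib_right by (rule sum.swap)
  also have "\<dots> = 0" by (simp add: gradient_block)
  finally have 0: "(\<Sum>p\<in>S. P p * (1 - exp (tilt (Suc N) p)) * (tilt N p - tilt (Suc N) p)) = 0" .
  have "gap N - gap (Suc N) =
      (\<Sum>p\<in>S. P p * exp (tilt (Suc N) p) * (exp (tilt N p - tilt (Suc N) p) - 1 - (tilt N p - tilt (Suc N) p))
        - P p * (1 - exp (tilt (Suc N) p)) * (tilt N p - tilt (Suc N) p))"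
    unfolding gap_def sum_subtractf[symmetric]
  proof (rule sum.cong[OF refl])
    fix p
    have "exp (tilt N p) = exp (tilt (Suc N) p) * exp (tilt N p - tilt (Suc N) p)" by (simp flip: exp_add)
    thus "P p * (exp (tilt N p) - 1 - tilt N p) - P p * (exp (tilt (Suc N) p) - 1 - tilt (Suc N) p) =
        P p * exp (tilt (Suc N) p) * (exp (tilt N p - tilt (Suc N) p) - 1 - (tilt N p - tilt (Suc N) p))
        - P p * (1 - exp (tilt (Suc N) p)) * (tilt N p - tilt (Suc N) p)"
      by (simp add: algebra_simps)
  qed
  thus ?thesis by (simp add: sum_subtractf 0)
qed

lemma gap_Suc_le: "gap (Suc N) \<le> gap N"
proof -
  have "0 \<le> gap N - gap (Suc N)"
    unfolding gap_decrease using P_pos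
    by (intro sum_nonneg mult_nonneg_nonneg exp_gap_nonneg) (auto simp: less_imp_le)
  thus ?thesis by simp
qed

lemma gap_antimono: "N \<le> N' \<Longrightarrow> gap N' \<le> gap N"
  using lift_Suc_antimono_le[of gap] gap_Suc_le by blast

section \<open>Quadratic bounds on the sublevel set\<close>

lemma P_lower: obtains c where "0 < c" "\<And>p. p \<in> S \<Longrightarrow> c \<le> P p"
proof (cases "S = {}")
  case False
  have "0 < Min (P ` S)" using False fin P_pos by simp
  moreover have "\<And>p. p \<in> S \<Longrightarrow> Min (P ` S) \<le> P p" using fin by simp
  ultimately show ?thesis using that by blast
qed (use that[of 1] in auto)

text \<open>All summands of \<open>gap N\<close> are nonnegative and
  \<open>gap N \<le> gap 0\<close>. With weights bounded below, each exponential gap is bounded, and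
  with it the tilt. No bound on \<open>x N\<close> itself is obtained here.\<close>

lemma tilt_bounded: obtains M where "0 \<le> M" "\<And>N p. p \<in> S \<Longrightarrow> \<bar>tilt N p\<bar> \<le> M"
proof -
  obtain c where c: "0 < c" "\<And>p. p \<in> S \<Longrightarrow> c \<le> P p" by (fact P_lower)
  have "\<bar>tilt N p\<bar> \<le> gap 0 / c + 1" if p: "p \<in> S" for N p
  proof -
    have "c * (exp (tilt N p) - 1 - tilt N p) \<le> P p * (exp (tilt N p) - 1 - tilt N p)"
      using c(2)[OF p] exp_gap_nonneg by (intro mult_right_mono) auto
    also have "\<dots> \<le> gap N"
      unfolding gap_def using fin p P_pos exp_gap_nonneg
      by (intro member_le_sum mult_nonneg_nonneg) (auto simp: less_imp_le)
    also have "\<dots> \<le> gap 0" by (simp add: gap_antimono)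
    finally have "exp (tilt N p) - 1 - tilt N p \<le> gap 0 / c" using c(1) by (simp add: field_simps)
    thus ?thesis using abs_le_exp_gap[of "tilt N p"] by linarith
  qed
  moreover have "0 \<le> gap 0 / c + 1" using c gap_nonneg[of 0] by simp
  ultimately show ?thesis using that by blast
qed

text \<open>On the bounded range of the tilts the exponential gap dominates a multiple of the
  square, both in \<open>gap\<close> itself and in the loss given by
  \<open>gap_decrease\<close>.\<close>

lemma tilt_le_sqrt_gap: obtains C where "0 \<le> C"
  "\<And>N p. p \<in> S \<Longrightarrow> \<bar>tilt N p\<bar> \<le> C * sqrt (gap N)"
  "\<And>N p. p \<in> S \<Longrightarrow> \<bar>tilt N p - tilt (Suc N) p\<bar> \<le> C * sqrt (gap N - gap (Suc N))"
proof -
  obtain c where c: "0 < c" "\<And>p. p \<in> S \<Longrightarrow> c \<le> P p" by (fact P_lower)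
  obtain M where M: "0 \<le> M" "\<And>N p. p \<in> S \<Longrightarrow> \<bar>tilt N p\<bar> \<le> M" by (fact tilt_bounded)
  \<comment> \<open>The three factors bound the weight \<open>P p\<close>, the density
    \<open>exp (tilt (Suc N) p)\<close>, and the quadratic coefficient for differences of tilts,
    which range up to \<open>2 * M\<close>.\<close>
  define d where "d = c * exp (- M) * (exp (- (2 * M)) / 2)"
  have d: "0 < d" using c by (simp add: d_def)
  have *: "\<bar>v\<bar> \<le> (1 / sqrt d) * sqrt g" if "d * v\<^sup>2 \<le> g" for v g
  proof -
    have "\<bar>v\<bar> = sqrt (v\<^sup>2)" by simp
    also have "\<dots> \<le> sqrt (g / d)" using that d by (intro real_sqrt_le_mono) (simp add: field_simps)
    finally show ?thesis by (simp add: real_sqrt_divide)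
  qed
  \<comment> \<open>Used with \<open>e = 1\<close> for the gap and with the density of the next
    iterate for its decrease.\<close>
  have term_le: "d * v\<^sup>2 \<le> P p * e * (exp v - 1 - v)"
    if p: "p \<in> S" and v: "\<bar>v\<bar> \<le> 2 * M" and e: "exp (- M) \<le> e" for p v e
  proof -
    have "0 \<le> e" using e exp_ge_zero[of "- M"] by linarith
    have "d * v\<^sup>2 = (c * exp (- M)) * (exp (- (2 * M)) / 2 * v\<^sup>2)" by (simp add: d_def)
    also have "\<dots> \<le> (P p * e) * (exp v - 1 - v)"
      using exp_gap_ge_square[OF v] c(1) c(2)[OF p] e \<open>0 \<le> e\<close> less_imp_le[OF P_pos[OF p]]
      by (intro mult_mono[of _ _ "_ / 2 * _"] mult_mono) auto
    finally show ?thesis .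
  qed
  have 1: "d * (tilt N p)\<^sup>2 \<le> gap N" if p: "p \<in> S" for N p
  proof -
    have "d * (tilt N p)\<^sup>2 \<le> P p * 1 * (exp (tilt N p) - 1 - tilt N p)"
      using M(1) M(2)[OF p, of N] by (intro term_le[OF p]) auto
    also have "\<dots> \<le> gap N"
      unfolding gap_def mult_1_right using fin p P_pos exp_gap_nonneg
      by (intro member_le_sum mult_nonneg_nonneg) (auto simp: less_imp_le)
    finally show ?thesis .
  qed
  have 2: "d * (tilt N p - tilt (Suc N) p)\<^sup>2 \<le> gap N - gap (Suc N)" if p: "p \<in> S" for N p
  proof -
    have "d * (tilt N p - tilt (Suc N) p)\<^sup>2 \<le>
        P p * exp (tilt (Suc N) p) * (exp (tilt N p - tilt (Suc N) p) - 1 - (tilt N p - tilt (Suc N) p))"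
      using M(2)[OF p, of N] M(2)[OF p, of "Suc N"] by (intro term_le[OF p]) auto
    also have "\<dots> \<le> gap N - gap (Suc N)"
      unfolding gap_decrease using fin p P_pos exp_gap_nonneg
      by (intro member_le_sum mult_nonneg_nonneg) (auto simp: less_imp_le)
    finally show ?thesis .
  qed
  show ?thesis
    using that[of "1 / sqrt d"] *[OF 1] *[OF 2] d by simp
qed

text \<open>Every coordinate is scaled within the next \<open>K\<close> steps, and its gradient is
  zero right afterwards. The present gradient is thus a change over at most \<open>K\<close> steps,
  which the bounds on the changes of the tilts control.\<close>

lemma gradient_le: obtains C where "0 \<le> C"
  "\<And>N i. i \<in> I \<Longrightarrow> \<bar>gradient N i\<bar> \<le> C * sqrt (gap N - gap (N + K))"
proof -
  obtain C where C: "0 \<le> C"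
    "\<And>N p. p \<in> S \<Longrightarrow> \<bar>tilt N p\<bar> \<le> C * sqrt (gap N)"
    "\<And>N p. p \<in> S \<Longrightarrow> \<bar>tilt N p - tilt (Suc N) p\<bar> \<le> C * sqrt (gap N - gap (Suc N))"
    by (fact tilt_le_sqrt_gap)
  obtain M where M: "0 \<le> M" "\<And>N p. p \<in> S \<Longrightarrow> \<bar>tilt N p\<bar> \<le> M" by (fact tilt_bounded)
  define w where "w N = sqrt (gap N - gap (N + K))" for N
  have w0: "0 \<le> w N" for N using gap_antimono[of N "N + K"] by (simp add: w_def)
  \<comment> \<open>A single step inside the window loses at most as much gap as the whole window,
    since \<open>gap\<close> is nonincreasing.\<close>
  have near: "\<bar>tilt N p - tilt (N + r) p\<bar> \<le> real r * (C * w N)" if p: "p \<in> S" and r: "r \<le> K" for N p r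
    using r
  proof (induction r)
    case (Suc r)
    have "gap (N + r) - gap (Suc (N + r)) \<le> gap N - gap (N + K)"
      using gap_antimono[of N "N + r"] gap_antimono[of "Suc (N + r)" "N + K"] Suc.prems by linarith
    hence "C * sqrt (gap (N + r) - gap (Suc (N + r))) \<le> C * w N"
      using C(1) unfolding w_def by (intro mult_left_mono real_sqrt_le_mono)
    hence "\<bar>tilt (N + r) p - tilt (Suc (N + r)) p\<bar> \<le> C * w N"
      using C(3)[OF p, of "N + r"] by linarith
    thus ?case using Suc by (simp add: algebra_simps)
  qed simp
  define D where "D = (\<Sum>p\<in>S. P p * exp M * (real K * C))"
  have "\<bar>gradient N i\<bar> \<le> D * w N" if i: "i \<in> I" for N i
  proof -
    obtain r where r: "r < K" "i \<in> B (N + r)" using window[OF i] by blast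
    \<comment> \<open>The scaling in step \<open>N + r\<close> takes effect at index
      \<open>N + Suc r\<close>; as \<open>r < K\<close>, this index still lies in the
      window.\<close>
    have "\<bar>gradient N i\<bar> = \<bar>gradient N i - gradient (N + Suc r) i\<bar>" using gradient_block[OF r(2)] by simp
    also have "\<dots> = \<bar>\<Sum>p\<in>S. a p i * (P p * (exp (tilt (N + Suc r) p) - exp (tilt N p)))\<bar>"
      by (simp add: gradient_def sum_subtractf[symmetric] algebra_simps)
    also have "\<dots> \<le> (\<Sum>p\<in>S. \<bar>a p i * (P p * (exp (tilt (N + Suc r) p) - exp (tilt N p)))\<bar>)"
      by (rule sum_abs)
    also have "\<dots> \<le> (\<Sum>p\<in>S. P p * exp M * (real K * C) * w N)"
    proof (rule sum_mono)
      fix p assume p: "p \<in> S"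
      have "\<bar>exp (tilt (N + Suc r) p) - exp (tilt N p)\<bar> \<le> exp M * \<bar>tilt (N + Suc r) p - tilt N p\<bar>"
        using M p by (intro exp_diff_le)
      also have "\<dots> \<le> exp M * (real K * (C * w N))"
      proof -
        have "\<bar>tilt (N + Suc r) p - tilt N p\<bar> \<le> real (Suc r) * (C * w N)"
          using near[OF p, of "Suc r" N] r(1) by simp
        also have "\<dots> \<le> real K * (C * w N)"
          using r(1) C(1) w0[of N] by (intro mult_right_mono mult_nonneg_nonneg) auto
        finally show ?thesis by simp
      qed
      finally have e: "\<bar>exp (tilt (N + Suc r) p) - exp (tilt N p)\<bar> \<le> exp M * (real K * (C * w N))" .
      have "\<bar>a p i * (P p * (exp (tilt (N + Suc r) p) - exp (tilt N p)))\<bar> =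
          \<bar>a p i\<bar> * (P p * \<bar>exp (tilt (N + Suc r) p) - exp (tilt N p)\<bar>)"
        using P_pos[OF p] by (simp add: abs_mult)
      also have "\<dots> \<le> 1 * (P p * (exp M * (real K * (C * w N))))"
        using P_pos[OF p] a_le[OF p i] e by (intro mult_mono mult_left_mono) auto
      finally show "\<bar>a p i * (P p * (exp (tilt (N + Suc r) p) - exp (tilt N p)))\<bar> \<le>
          P p * exp M * (real K * C) * w N" by (simp add: mult_ac)
    qed
    finally show ?thesis by (simp add: D_def sum_distrib_right)
  qed
  moreover have "0 \<le> D"
    unfolding D_def using C P_pos by (intro sum_nonneg mult_nonneg_nonneg) (auto simp: less_imp_le)
  ultimately show ?thesis using that unfolding w_def by blast
qed

text \<open>
  \<open>gradient N\<close> annihilates every direction that no path sees, so \<open>x\<^sub>* - x N\<close> may be replaced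
  by a vector of size comparable to \<open>tilt N\<close>.
\<close>

lemma gap_le_gradient: obtains C where "0 \<le> C"
  "\<And>N g. (\<And>i. i \<in> I \<Longrightarrow> \<bar>gradient N i\<bar> \<le> g) \<Longrightarrow> gap N \<le> C * g * sqrt (gap N)"
proof -
  obtain C where C: "0 \<le> C"
    "\<And>N p. p \<in> S \<Longrightarrow> \<bar>tilt N p\<bar> \<le> C * sqrt (gap N)"
    "\<And>N p. p \<in> S \<Longrightarrow> \<bar>tilt N p - tilt (Suc N) p\<bar> \<le> C * sqrt (gap N - gap (Suc N))"
    by (fact tilt_le_sqrt_gap)
  obtain L where L: "0 \<le> L"
    and y: "\<And>x. \<exists>y. (\<forall>p\<in>S. (\<Sum>i\<in>I. a p i * y i) = (\<Sum>i\<in>I. a p i * x i)) \<and>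
           (\<Sum>i\<in>I. \<bar>y i\<bar>) \<le> L * (\<Sum>p\<in>S. \<bar>\<Sum>i\<in>I. a p i * x i\<bar>)"
    using linear_section_bounded[OF fin, of a] by blast
  have "gap N \<le> (L * real (card S) * C) * g * sqrt (gap N)" if g: "\<And>i. i \<in> I \<Longrightarrow> \<bar>gradient N i\<bar> \<le> g" for N g
  proof (cases "I = {}")
    \<comment> \<open>Without coordinates nothing forces \<open>0 \<le> g\<close>, but all tilts are
      zero.\<close>
    case True
    hence "tilt N p = 0" for p unfolding tilt_def by simp
    hence "gap N = 0" unfolding gap_def by simp
    thus ?thesis by simp
  next
    case False
    hence g0: "0 \<le> g" using g by (meson abs_ge_zero all_not_in_conv order_trans)
    obtain y where y: "\<And>p. p \<in> S \<Longrightarrow> (\<Sum>i\<in>I. a p i * y i) = tilt N p"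
      "(\<Sum>i\<in>I. \<bar>y i\<bar>) \<le> L * (\<Sum>p\<in>S. \<bar>tilt N p\<bar>)"
      using y[of "\<lambda>i. x N i - xs i"] unfolding tilt_def by blast
    \<comment> \<open>Convexity of the exponential gap, whose minimum is zero at the origin: its
      value is at most its slope times the argument.\<close>
    have "gap N \<le> (\<Sum>p\<in>S. P p * ((exp (tilt N p) - 1) * tilt N p))"
      unfolding gap_def
    proof (intro sum_mono mult_left_mono)
      fix p
      have "exp (tilt N p) * (1 - tilt N p) \<le> exp (tilt N p) * exp (- tilt N p)"
        using exp_ge_add_one_self[of "- tilt N p"] by (intro mult_left_mono) auto
      thus "exp (tilt N p) - 1 - tilt N p \<le> (exp (tilt N p) - 1) * tilt N p"
        by (simp add: algebra_simps exp_minus)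
    qed (use P_pos in \<open>auto simp: less_imp_le\<close>)
    \<comment> \<open>The tilt is expressed through \<open>y\<close> instead of
      \<open>x N - xs\<close>; exchanging the sums produces the gradient, and the size of
      \<open>y\<close> is controlled by the tilts.\<close>
    also have "\<dots> = (\<Sum>p\<in>S. \<Sum>i\<in>I. - (a p i * (P p * (1 - exp (tilt N p))) * y i))"
    proof (rule sum.cong[OF refl])
      fix p assume p: "p \<in> S"
      have "P p * ((exp (tilt N p) - 1) * tilt N p) = P p * ((exp (tilt N p) - 1) * (\<Sum>i\<in>I. a p i * y i))"
        by (simp only: y(1)[OF p])
      thus "P p * ((exp (tilt N p) - 1) * tilt N p) = (\<Sum>i\<in>I. - (a p i * (P p * (1 - exp (tilt N p))) * y i))"
        by (simp add: sum_distrib_left sum_subtractf algebra_simps)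
    qed
    also have "\<dots> = (\<Sum>i\<in>I. - (gradient N i * y i))"
      unfolding gradient_def sum_distrib_right sum_negf[symmetric] by (rule sum.swap)
    also have "\<dots> \<le> (\<Sum>i\<in>I. g * \<bar>y i\<bar>)"
    proof (rule sum_mono)
      fix i assume "i \<in> I"
      hence "\<bar>gradient N i * y i\<bar> \<le> g * \<bar>y i\<bar>" using g by (simp add: abs_mult mult_right_mono)
      thus "- (gradient N i * y i) \<le> g * \<bar>y i\<bar>" by linarith
    qed
    also have "\<dots> \<le> g * (L * (\<Sum>p\<in>S. \<bar>tilt N p\<bar>))"
      unfolding sum_distrib_left[symmetric] using y(2) g0 by (intro mult_left_mono)
    also have "\<dots> \<le> g * (L * (\<Sum>p\<in>S. C * sqrt (gap N)))"
      using C(2) g0 L by (intro mult_left_mono sum_mono)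
    also have "\<dots> = (L * real (card S) * C) * g * sqrt (gap N)" by simp
    finally show ?thesis .
  qed
  moreover have "0 \<le> L * real (card S) * C" using C L by simp
  ultimately show ?thesis using that by blast
qed

section \<open>Geometric decay and convergence of the iterates\<close>

lemma gap_contracts: obtains r where "0 \<le> r" "r < 1" "\<And>N. gap (N + K) \<le> r * gap N"
proof -
  obtain C1 where C1: "0 \<le> C1" "\<And>N i. i \<in> I \<Longrightarrow> \<bar>gradient N i\<bar> \<le> C1 * sqrt (gap N - gap (N + K))"
    by (fact gradient_le)
  obtain C2 where C2: "0 \<le> C2"
    "\<And>N g. (\<And>i. i \<in> I \<Longrightarrow> \<bar>gradient N i\<bar> \<le> g) \<Longrightarrow> gap N \<le> C2 * g * sqrt (gap N)"
    by (fact gap_le_gradient)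
  \<comment> \<open>Adding one keeps \<open>Q\<close> at least one, so that \<open>1 - 1 / Q\<close>
    is a nonnegative factor below one.\<close>
  define Q where "Q = (C2 * C1)\<^sup>2 + 1"
  have Q: "1 \<le> Q" by (simp add: Q_def)
  have "gap (N + K) \<le> (1 - 1 / Q) * gap N" for N
  proof -
    define d where "d = gap N - gap (N + K)"
    have d: "0 \<le> d" using gap_antimono[of N "N + K"] by (simp add: d_def)
    \<comment> \<open>The two gradient bounds combine to an inequality with \<open>sqrt d\<close>
      and \<open>sqrt (gap N)\<close>; squaring and cancelling \<open>gap N\<close> leaves a bound
      by the loss \<open>d\<close> over the window.\<close>
    have "gap N \<le> C2 * C1 * sqrt d * sqrt (gap N)"
      using C2(2)[of N, OF C1(2)] by (simp add: d_def mult_ac)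
    hence "(gap N)\<^sup>2 \<le> (C2 * C1 * sqrt d * sqrt (gap N))\<^sup>2"
      using gap_nonneg by (intro power_mono)
    also have "\<dots> = ((C2 * C1)\<^sup>2 * d) * gap N"
      using d gap_nonneg[of N] by (simp add: power_mult_distrib)
    finally have "gap N * gap N \<le> ((C2 * C1)\<^sup>2 * d) * gap N" by (simp only: power2_eq_square)
    hence "gap N \<le> (C2 * C1)\<^sup>2 * d"
      using gap_nonneg[of N] d by (cases "gap N = 0") (auto simp: mult_le_cancel_right)
    also have "\<dots> \<le> Q * d" using d by (intro mult_right_mono) (auto simp: Q_def)
    finally show ?thesis using Q by (simp add: d_def field_simps)
  qed
  thus ?thesis using that[of "1 - 1 / Q"] Q by simp
qed

lemma summable_sqrt_gap: "summable (\<lambda>N. sqrt (gap N))"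
proof -
  obtain r where r: "0 \<le> r" "r < 1" "\<And>N. gap (N + K) \<le> r * gap N" by (fact gap_contracts)
  show ?thesis
  proof (rule summable_if_window_contraction[of _ "sqrt r" K])
    show "sqrt (gap (N + K)) \<le> sqrt r * sqrt (gap N)" for N
      unfolding real_sqrt_mult[symmetric] by (rule real_sqrt_le_mono[OF r(3)])
  qed (use r gap_nonneg in auto)
qed

text \<open>A path with entry one at \<open>i\<close> sees no other coordinate of the block, so the
  step in coordinate \<open>i\<close> has the size of the change of its tilt, and these changes are
  summable. This also settles the components of \<open>x N\<close> that no tilt sees.\<close>

theorem convergent_iterates: "i \<in> I \<Longrightarrow> convergent (\<lambda>N. x N i)"
proof -
  assume i: "i \<in> I"
  obtain C where C: "0 \<le> C"
    "\<And>N p. p \<in> S \<Longrightarrow> \<bar>tilt N p\<bar> \<le> C * sqrt (gap N)"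
    "\<And>N p. p \<in> S \<Longrightarrow> \<bar>tilt N p - tilt (Suc N) p\<bar> \<le> C * sqrt (gap N - gap (Suc N))"
    by (fact tilt_le_sqrt_gap)
  show ?thesis
  proof (rule convergent_if_summable_steps[OF summable_sqrt_gap])
    fix N
    show "\<bar>x (Suc N) i - x N i\<bar> \<le> C * sqrt (gap N)"
    proof (cases "i \<in> B N")
      case True
      obtain p where p: "p \<in> S" "a p i = 1" using covered[OF i] by blast
      have "tilt N p - tilt (Suc N) p = (\<Sum>j\<in>{i}. a p j * (x N j - x (Suc N) j))"
      proof -
        have "a p j = 0" if "j \<in> B N - {i}" for j
          using block_single[OF p(1) True, of j] p(2) that by fastforce
        moreover have "finite (B N)" by (rule finite_subset[OF block_subset fin(2)])
        ultimately show ?thesis unfolding tilt_step using True by (intro sum.mono_neutral_right) simp_all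
      qed
      hence "\<bar>x (Suc N) i - x N i\<bar> = \<bar>tilt N p - tilt (Suc N) p\<bar>" using p by simp
      also have "\<dots> \<le> C * sqrt (gap N - gap (Suc N))" by (rule C(3)[OF p(1)])
      also have "\<dots> \<le> C * sqrt (gap N)"
        using gap_nonneg[of "Suc N"] C(1) by (intro mult_left_mono real_sqrt_le_mono) auto
      finally show ?thesis .
    qed (use unchanged[OF i] C gap_nonneg in auto)
  qed
qed

theorem tilt_tendsto_0: "p \<in> S \<Longrightarrow> (\<lambda>N. tilt N p) \<longlonglongrightarrow> 0"
proof -
  assume p: "p \<in> S"
  obtain C where C: "0 \<le> C"
    "\<And>N p. p \<in> S \<Longrightarrow> \<bar>tilt N p\<bar> \<le> C * sqrt (gap N)"
    "\<And>N p. p \<in> S \<Longrightarrow> \<bar>tilt N p - tilt (Suc N) p\<bar> \<le> C * sqrt (gap N - gap (Suc N))"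
    by (fact tilt_le_sqrt_gap)
  have "(\<lambda>N. C * sqrt (gap N)) \<longlonglongrightarrow> C * 0"
    by (intro tendsto_mult_left summable_LIMSEQ_zero summable_sqrt_gap)
  hence lim: "(\<lambda>N. C * sqrt (gap N)) \<longlonglongrightarrow> 0" by simp
  have "(\<lambda>N. \<bar>tilt N p\<bar>) \<longlonglongrightarrow> 0"
    by (rule tendsto_sandwich[OF _ _ tendsto_const lim]) (use C(2)[OF p] in auto)
  thus ?thesis by (rule tendsto_rabs_zero_cancel)
qed

end

subsection \<open>Path expansion of the messages\<close>

lemma mult_mat_vec_index:
  fixes M :: "real mat"
  assumes "M \<in> carrier_mat m n" "v \<in> carrier_vec n" "i < m"
  shows "(M *\<^sub>v v) $ i = (\<Sum>j<n. M $$ (i, j) * v $ j)"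
  using assms by (auto simp: scalar_prod_def atLeast0LessThan intro!: sum.cong)

lemma transpose_mult_vec_index:
  fixes M :: "real mat"
  assumes "M \<in> carrier_mat m n" "v \<in> carrier_vec m" "i < n"
  shows "(transpose_mat M *\<^sub>v v) $ i = (\<Sum>j<m. M $$ (j, i) * v $ j)"
  using assms by (auto simp: scalar_prod_def atLeast0LessThan intro!: sum.cong)

lemma vec_times_index [simp]: "i < dim_vec x \<Longrightarrow> (x \<odot>\<^sub>v y) $ i = x $ i * y $ i"
  and vec_times_carrier [simp]: "x \<in> carrier_vec n \<Longrightarrow> x \<odot>\<^sub>v y \<in> carrier_vec n"
  and vec_times_dim [simp]: "dim_vec (x \<odot>\<^sub>v y) = dim_vec x"
  by (auto simp: vec_times_def)

lemma vec_divide_index [simp]: "i < dim_vec x \<Longrightarrow> (x \<oslash>\<^sub>v y) $ i = x $ i / y $ i"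
  and vec_divide_carrier [simp]: "x \<in> carrier_vec n \<Longrightarrow> x \<oslash>\<^sub>v y \<in> carrier_vec n"
  and vec_divide_dim [simp]: "dim_vec (x \<oslash>\<^sub>v y) = dim_vec x"
  by (auto simp: vec_divide_def)

lemma ones_carrier [simp]: "ones n \<in> carrier_vec n"
  and ones_index [simp]: "i < n \<Longrightarrow> ones n $ i = 1"
  and dim_ones [simp]: "dim_vec (ones n) = n"
  by (auto simp: ones_def)

lemma selection_mat_carrier [simp]: "selection_mat n xs \<in> carrier_mat (length xs) n"
  using mat_of_rows_carrier(1)[of n "map (unit_vec n) xs"] by (simp add: selection_mat_def)

lemma selection_mat_dims [simp]:
  "dim_row (selection_mat n xs) = length xs" "dim_col (selection_mat n xs) = n"
  by (rule carrier_matD[OF selection_mat_carrier])+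

lemma selection_mat_index:
  "i < length xs \<Longrightarrow> j < n \<Longrightarrow> selection_mat n xs $$ (i, j) = of_bool (xs ! i = j)"
  by (auto simp: selection_mat_def mat_of_rows_index unit_vec_def)

lemma selection_mat_mult_index:
  assumes "v \<in> carrier_vec n" "j < length xs" "xs ! j < n"
  shows "(selection_mat n xs *\<^sub>v v) $ j = v $ (xs ! j)"
proof -
  have "(selection_mat n xs *\<^sub>v v) $ j = (\<Sum>i<n. of_bool (xs ! j = i) * v $ i)"
    using assms by (simp add: mult_mat_vec_index[OF selection_mat_carrier] selection_mat_index del: index_mult_mat_vec)
  also have "\<dots> = (\<Sum>i<n. if xs ! j = i then v $ i else 0)" by (intro sum.cong) auto
  finally show ?thesis using assms(3) by simp
qed

lemma selection_mat_transpose_mult_index: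
  assumes "v \<in> carrier_vec (length xs)" "i < n"
  shows "(transpose_mat (selection_mat n xs) *\<^sub>v v) $ i = (\<Sum>j<length xs. of_bool (xs ! j = i) * v $ j)"
  using assms
  by (simp add: transpose_mult_vec_index[OF selection_mat_carrier] selection_mat_index del: index_mult_mat_vec)

lemma selection_mat_transpose_mult_selected:
  assumes "v \<in> carrier_vec (length xs)" "distinct xs" "j < length xs" "xs ! j < n"
  shows "(transpose_mat (selection_mat n xs) *\<^sub>v v) $ (xs ! j) = v $ j"
proof -
  have "(\<Sum>j'<length xs. of_bool (xs ! j' = xs ! j) * v $ j') = (\<Sum>j'<length xs. if j = j' then v $ j' else 0)"
    using assms by (intro sum.cong) (auto simp: nth_eq_iff_index_eq)
  thus ?thesis using assms by (simp add: selection_mat_transpose_mult_index del: index_mult_mat_vec)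
qed

lemma selection_mat_transpose_mult_unselected:
  assumes "v \<in> carrier_vec (length xs)" "i < n" "i \<notin> set xs"
  shows "(transpose_mat (selection_mat n xs) *\<^sub>v v) $ i = 0"
  using assms by (auto simp: selection_mat_transpose_mult_index in_set_conv_nth simp del: index_mult_mat_vec intro!: sum.neutral)

lemma transpose_mult_carrier [simp]:
  "M \<in> carrier_mat m n \<Longrightarrow> transpose_mat M *\<^sub>v v \<in> carrier_vec n"
  by (auto simp: mult_mat_vec_def)

lemma mult_mat_vec_carrier' [simp]: "M \<in> carrier_mat m n \<Longrightarrow> M *\<^sub>v v \<in> carrier_vec m"
  by (auto simp: mult_mat_vec_def)

text \<open>\<open>division\<close> says coordinatewise that the updates are defined at every
  scaling by multipliers. The messages are nonnegative, so the denominators are then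
  positive.\<close>

locale scaling_problem =
  fixes n T k :: nat and \<pi> :: "nat list" and A :: "nat \<Rightarrow> real mat" and \<rho> :: "nat \<Rightarrow> real vec"
    and \<mu> :: "real vec"
  assumes A_carrier: "t < T \<Longrightarrow> A t \<in> carrier_mat n n"
    and A_nonneg: "t < T \<Longrightarrow> i < n \<Longrightarrow> j < n \<Longrightarrow> 0 \<le> A t $$ (i, j)"
    and distinct: "distinct \<pi>" and \<pi>_subset: "set \<pi> \<subseteq> {..<n}" and length_\<pi>: "length \<pi> = k"
    and \<rho>_carrier: "t \<le> T \<Longrightarrow> \<rho> t \<in> carrier_vec k"
    and \<rho>_nonneg: "t \<le> T \<Longrightarrow> j < k \<Longrightarrow> 0 \<le> \<rho> t $ j"
    and \<mu>_carrier: "\<mu> \<in> carrier_vec n"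
    and \<mu>_nonneg: "i < n \<Longrightarrow> 0 \<le> \<mu> $ i"
    and division: "lam \<in> multipliers T k \<Longrightarrow> t \<le> T \<Longrightarrow> j < k \<Longrightarrow>
      phi n T A (scaling (selection_mat n \<pi>) lam) t $ (\<pi> ! j) *
        phi_hat A \<mu> (scaling (selection_mat n \<pi>) lam) t $ (\<pi> ! j) \<noteq> 0"
begin

abbreviation C where "C \<equiv> selection_mat n \<pi>"

abbreviation Cbar where "Cbar \<equiv> selection_mat n (sorted_list_of_set ({..<n} - set \<pi>))"

abbreviation ph where "ph \<equiv> phi_hat A \<mu>"

abbreviation pf where "pf \<equiv> phi n T A"

lemma \<pi>_less [simp]: "j < k \<Longrightarrow> \<pi> ! j < n"
  using \<pi>_subset length_\<pi> nth_mem by fastforce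

definition positive :: "(nat \<Rightarrow> real vec) \<Rightarrow> bool" where
  "positive u \<longleftrightarrow> (\<forall>t\<le>T. u t \<in> carrier_vec n \<and> (\<forall>i<n. 0 < u t $ i))"

text \<open>Kept apart from \<open>positive\<close> because \<open>marginal_path_sum\<close> sets
  entries of one block to zero.\<close>

definition sized :: "(nat \<Rightarrow> real vec) \<Rightarrow> bool" where
  "sized u \<longleftrightarrow> (\<forall>t\<le>T. u t \<in> carrier_vec n)"

lemma positive_sized: "positive u \<Longrightarrow> sized u"
  by (simp add: positive_def sized_def)

lemma sizedD [simp]: "sized u \<Longrightarrow> t \<le> T \<Longrightarrow> u t \<in> carrier_vec n"
  by (simp add: sized_def)

lemma sized_dim [simp]: "sized u \<Longrightarrow> t \<le> T \<Longrightarrow> dim_vec (u t) = n"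
  by (simp add: sized_def)

lemma scaling_carrier: "scaling C lam t \<in> carrier_vec n"
  unfolding scaling_def using transpose_mult_carrier[OF selection_mat_carrier] by simp

lemma scaling_sized: "sized (scaling C lam)"
  by (simp add: sized_def scaling_carrier)

lemma scaling_index: "i < n \<Longrightarrow> scaling C lam t $ i = exp ((transpose_mat C *\<^sub>v lam t) $ i)"
  unfolding scaling_def by (subst index_map_vec) auto

lemma scaling_positive: "positive (scaling C lam)"
  by (simp add: positive_def scaling_carrier scaling_index del: index_mult_mat_vec)

lemma scaling_observed: "lam t \<in> carrier_vec k \<Longrightarrow> j < k \<Longrightarrow> scaling C lam t $ (\<pi> ! j) = exp (lam t $ j)"
  by (simp add: scaling_index selection_mat_transpose_mult_selected distinct length_\<pi> del: index_mult_mat_vec)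

lemma scaling_unobserved: "lam t \<in> carrier_vec k \<Longrightarrow> i < n \<Longrightarrow> i \<notin> set \<pi> \<Longrightarrow> scaling C lam t $ i = 1"
  by (simp add: scaling_index selection_mat_transpose_mult_unselected length_\<pi> del: index_mult_mat_vec)

lemma scaling_update: "scaling C (lam(t := x)) = (scaling C lam)(t := scaling C (\<lambda>_. x) t)"
  by (auto simp: scaling_def)

section \<open>The forward and backward messages\<close>

lemma phi_T: "T \<le> t \<Longrightarrow> pf u t = ones n"
  by (subst phi.simps) simp

lemma phi_Suc: "t < T \<Longrightarrow> pf u t = A t *\<^sub>v (u (Suc t) \<odot>\<^sub>v pf u (Suc t))"
  by (subst phi.simps) simp

lemma phi_carrier [simp]: "pf u t \<in> carrier_vec n"
  using A_carrier[of t] phi_T[of t u] phi_Suc[of t u] by (cases "t < T") auto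

lemma phi_hat_carrier [simp]: "t \<le> T \<Longrightarrow> ph u t \<in> carrier_vec n"
  using transpose_mult_carrier[OF A_carrier] \<mu>_carrier by (cases t) auto

lemma phi_hat_dim [simp]: "t \<le> T \<Longrightarrow> dim_vec (ph u t) = n"
  using phi_hat_carrier by (rule carrier_vecD)

lemma phi_index: "sized u \<Longrightarrow> t < T \<Longrightarrow> i < n \<Longrightarrow>
  pf u t $ i = (\<Sum>j<n. A t $$ (i, j) * (u (Suc t) $ j * pf u (Suc t) $ j))"
  by (simp add: phi_Suc mult_mat_vec_index[OF A_carrier] del: index_mult_mat_vec)

lemma phi_hat_index: "t < T \<Longrightarrow> i < n \<Longrightarrow>
  ph u (Suc t) $ i = (\<Sum>j<n. A t $$ (j, i) * (ph u t $ j * u t $ j))"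
  by (simp add: transpose_mult_vec_index[OF A_carrier] del: index_mult_mat_vec)

text \<open>Neither this message nor the forward one at \<open>t\<close> reads block
  \<open>t\<close>, which is what makes a block step explicit.\<close>

lemma phi_cong: "t \<le> T \<Longrightarrow> (\<And>s. t < s \<Longrightarrow> s \<le> T \<Longrightarrow> u s = u' s) \<Longrightarrow> pf u t = pf u' t"
proof (induction rule: inc_induct)
  case base
  show ?case by (simp add: phi_T)
next
  case (step t)
  thus ?case by (simp add: phi_Suc)
qed

lemma phi_hat_cong: "(\<And>s. s < t \<Longrightarrow> u s = u' s) \<Longrightarrow> ph u t = ph u' t"
  by (induction t) auto

lemma phi_nonneg: "t \<le> T \<Longrightarrow> positive u \<Longrightarrow> i < n \<Longrightarrow> 0 \<le> pf u t $ i"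
proof (induction arbitrary: i rule: inc_induct)
  case base
  thus ?case by (simp add: phi_T)
next
  case (step t)
  thus ?case
    using A_nonneg by (auto simp: phi_index positive_sized positive_def less_imp_le intro!: sum_nonneg mult_nonneg_nonneg)
qed

lemma phi_hat_nonneg: "t \<le> T \<Longrightarrow> positive u \<Longrightarrow> i < n \<Longrightarrow> 0 \<le> ph u t $ i"
proof (induction t arbitrary: i)
  case 0
  thus ?case by (simp add: \<mu>_nonneg)
next
  case (Suc t)
  thus ?case
    using A_nonneg by (auto simp: phi_hat_index positive_def less_imp_le simp del: phi_hat.simps intro!: sum_nonneg mult_nonneg_nonneg)
qed

text \<open>The term that the dual objective subtracts, which is the total mass of the scaled path
  measure.\<close>

definition total :: "(nat \<Rightarrow> real vec) \<Rightarrow> real" where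
  "total u = (\<Sum>i<n. ph u T $ i * u T $ i)"

text \<open>The forward and the backward recursion are adjoint to each other, so pairing the
  messages gives the same value at every time.\<close>

lemma total_eq: "t \<le> T \<Longrightarrow> sized u \<Longrightarrow> total u = (\<Sum>i<n. ph u t $ i * u t $ i * pf u t $ i)"
proof (induction rule: inc_induct)
  case base
  show ?case by (simp add: total_def phi_T)
next
  case (step t)
  have "(\<Sum>i<n. ph u (Suc t) $ i * u (Suc t) $ i * pf u (Suc t) $ i) =
      (\<Sum>i<n. \<Sum>j<n. ph u t $ j * u t $ j * (A t $$ (j, i) * (u (Suc t) $ i * pf u (Suc t) $ i)))"
    using step by (simp add: phi_hat_index sum_distrib_left sum_distrib_right mult_ac del: phi_hat.simps)
  also have "\<dots> = (\<Sum>j<n. ph u t $ j * u t $ j * pf u t $ j)"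
    using step by (subst sum.swap) (simp add: phi_index sum_distrib_left)
  finally show ?case using step by simp
qed

section \<open>Path sums\<close>

definition path_weight :: "(nat \<Rightarrow> nat) \<Rightarrow> real" where
  "path_weight p = \<mu> $ p 0 * (\<Prod>t<T. A t $$ (p t, p (Suc t)))"

definition paths :: "(nat \<Rightarrow> nat) set" where
  "paths = {..T} \<rightarrow>\<^sub>E {..<n}"

lemma finite_paths: "finite paths"
  unfolding paths_def by (intro finite_PiE) auto

lemma path_less: "p \<in> paths \<Longrightarrow> t \<le> T \<Longrightarrow> p t < n"
  unfolding paths_def by (auto simp: PiE_iff)

lemma path_weight_nonneg: "p \<in> paths \<Longrightarrow> 0 \<le> path_weight p"
  unfolding path_weight_def using A_nonneg \<mu>_nonneg path_less
  by (intro mult_nonneg_nonneg prod_nonneg ballI) auto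

text \<open>The test function \<open>v\<close> at the end point carries the induction: the last
  transition and scaling are absorbed into it, and a path up to \<open>Suc t\<close> is a path up to
  \<open>t\<close> with one state appended.\<close>

lemma phi_hat_path_sum:
  assumes "t \<le> T"
  shows "(\<Sum>i<n. ph u t $ i * u t $ i * v i) =
    (\<Sum>p \<in> {..t} \<rightarrow>\<^sub>E {..<n}.
      \<mu> $ p 0 * (\<Prod>r<t. A r $$ (p r, p (Suc r))) * (\<Prod>r\<le>t. u r $ p r) * v (p t))"
  using assms
proof (induction t arbitrary: v)
  case 0
  have "{..0::nat} \<rightarrow>\<^sub>E {..<n} = (\<lambda>i. (\<lambda>_. undefined)(0 := i)) ` {..<n}"
    using PiE_insert_eq[of 0 "{}" "\<lambda>_::nat. {..<n}"] by (auto simp: image_iff)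
  moreover have "inj_on (\<lambda>i::nat. (\<lambda>_::nat. undefined)(0 := i)) {..<n}"
    by (auto simp: inj_on_def fun_upd_def fun_eq_iff)
  ultimately show ?case by (simp add: sum.reindex mult_ac)
next
  case (Suc t)
  let ?w = "\<lambda>t p. \<mu> $ p 0 * (\<Prod>r<t. A r $$ (p r, p (Suc r))) * (\<Prod>r\<le>t. u r $ p r)"
  have Suc_t: "{..Suc t} = insert (Suc t) {..t}" by auto
  have "(\<Sum>i<n. ph u (Suc t) $ i * u (Suc t) $ i * v i) =
      (\<Sum>i<n. \<Sum>j<n. ph u t $ j * u t $ j * (A t $$ (j, i) * (u (Suc t) $ i * v i)))"
    using Suc.prems by (simp add: phi_hat_index sum_distrib_left sum_distrib_right mult_ac del: phi_hat.simps)
  also have "\<dots> = (\<Sum>j<n. ph u t $ j * u t $ j * (\<Sum>i<n. A t $$ (j, i) * (u (Suc t) $ i * v i)))"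
    by (subst sum.swap) (simp add: sum_distrib_left)
  also have "\<dots> = (\<Sum>p \<in> {..t} \<rightarrow>\<^sub>E {..<n}. ?w t p * (\<Sum>i<n. A t $$ (p t, i) * (u (Suc t) $ i * v i)))"
    using Suc by simp
  also have "\<dots> = (\<Sum>p \<in> {..t} \<rightarrow>\<^sub>E {..<n}. \<Sum>i<n. ?w t p * (A t $$ (p t, i) * (u (Suc t) $ i * v i)))"
    by (simp only: sum_distrib_left)
  also have "\<dots> = (\<Sum>i<n. \<Sum>p \<in> {..t} \<rightarrow>\<^sub>E {..<n}. ?w t p * (A t $$ (p t, i) * (u (Suc t) $ i * v i)))"
    by (rule sum.swap)
  also have "\<dots> = (\<Sum>(i, p) \<in> {..<n} \<times> ({..t} \<rightarrow>\<^sub>E {..<n}). ?w t p * (A t $$ (p t, i) * (u (Suc t) $ i * v i)))"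
    by (rule sum.cartesian_product)
  also have "\<dots> = (\<Sum>(i, p) \<in> {..<n} \<times> ({..t} \<rightarrow>\<^sub>E {..<n}). ?w (Suc t) (p(Suc t := i)) * v ((p(Suc t := i)) (Suc t)))"
  proof (rule sum.cong[OF refl], clarify)
    fix i :: nat and p :: "nat \<Rightarrow> nat"
    let ?p = "p(Suc t := i)"
    have "(\<Prod>r<t. A r $$ (?p r, ?p (Suc r))) = (\<Prod>r<t. A r $$ (p r, p (Suc r)))"
      by (intro prod.cong) auto
    moreover have "(\<Prod>r\<le>t. u r $ ?p r) = (\<Prod>r\<le>t. u r $ p r)"
      by (intro prod.cong) auto
    ultimately show "?w t p * (A t $$ (p t, i) * (u (Suc t) $ i * v i)) = ?w (Suc t) ?p * v (?p (Suc t))"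
      by (simp only: prod.lessThan_Suc prod.atMost_Suc) simp
  qed
  also have "\<dots> = (\<Sum>p \<in> {..Suc t} \<rightarrow>\<^sub>E {..<n}. ?w (Suc t) p * v (p (Suc t)))"
  proof -
    have "inj_on (\<lambda>(i, p). p(Suc t := i)) ({..<n} \<times> ({..t} \<rightarrow>\<^sub>E {..<n}))"
      by (rule inj_combinator) simp
    thus ?thesis unfolding Suc_t PiE_insert_eq
      by (subst sum.reindex) (simp_all only: o_def case_prod_unfold)
  qed
  finally show ?case .
qed

lemma total_path_sum: "total u = (\<Sum>p\<in>paths. path_weight p * (\<Prod>t\<le>T. u t $ p t))"
  using phi_hat_path_sum[of T u "\<lambda>_. 1"] by (simp add: total_def paths_def path_weight_def)

text \<open>Setting block \<open>t\<close> to zero off the state \<open>i\<close> leaves both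
  messages at \<open>t\<close> unchanged. The pairing at time \<open>t\<close> then has a single
  summand, while the path sum keeps the paths with \<open>p t = i\<close>.\<close>

lemma marginal_path_sum:
  assumes "t \<le> T" "sized u" "i < n"
  shows "ph u t $ i * u t $ i * pf u t $ i =
    (\<Sum>p\<in>paths. of_bool (p t = i) * (path_weight p * (\<Prod>t\<le>T. u t $ p t)))"
proof -
  define u' where "u' = u(t := vec n (\<lambda>j. of_bool (j = i) * u t $ j))"
  have "sized u'" using assms by (simp add: sized_def u'_def)
  have "ph u' t = ph u t" by (rule phi_hat_cong) (simp add: u'_def)
  moreover have "pf u' t = pf u t" by (rule phi_cong[OF assms(1)]) (simp add: u'_def)
  ultimately have "total u' = (\<Sum>j<n. ph u t $ j * (of_bool (j = i) * u t $ j) * pf u t $ j)"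
    using total_eq[OF assms(1) \<open>sized u'\<close>] by (simp add: u'_def)
  also have "\<dots> = (\<Sum>j<n. if j = i then ph u t $ j * u t $ j * pf u t $ j else 0)"
    by (intro sum.cong) auto
  finally have "total u' = ph u t $ i * u t $ i * pf u t $ i" using assms(3) by simp
  moreover have "(\<Prod>r\<le>T. u' r $ p r) = of_bool (p t = i) * (\<Prod>r\<le>T. u r $ p r)" if "p \<in> paths" for p
  proof -
    have "(\<Prod>r\<le>T. u' r $ p r) = u' t $ p t * (\<Prod>r\<in>{..T} - {t}. u' r $ p r)"
      using assms(1) by (intro prod.remove) auto
    also have "(\<Prod>r\<in>{..T} - {t}. u' r $ p r) = (\<Prod>r\<in>{..T} - {t}. u r $ p r)"
      by (intro prod.cong) (auto simp: u'_def)
    also have "u' t $ p t = of_bool (p t = i) * u t $ p t"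
      using path_less[OF that assms(1)] by (simp add: u'_def)
    also have "of_bool (p t = i) * u t $ p t * (\<Prod>r\<in>{..T} - {t}. u r $ p r) = of_bool (p t = i) * (\<Prod>r\<le>T. u r $ p r)"
      using assms(1) by (subst prod.remove[of "{..T}" t]) auto
    finally show ?thesis .
  qed
  ultimately show ?thesis unfolding total_path_sum by (simp add: mult_ac)
qed

lemma scaled_product_carrier: "t \<le> T \<Longrightarrow> sized u \<Longrightarrow> scaled_product n A u t \<in> carrier_mat n n"
proof (induction t)
  case (Suc t)
  have "diag_of (u t) \<in> carrier_mat n n"
    using sized_dim[OF Suc.prems(2), of t] Suc.prems unfolding diag_of_def by simp
  thus ?case using Suc A_carrier[of t] by auto
qed simp

text \<open>The factors are moved onto \<mu> one by one, which reproduces the forward recursion.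
  With \<open>x\<close> arbitrary, the last matrix and the diagonal factor can first be applied to
  it.\<close>

lemma scaled_product_scalar:
  "t \<le> T \<Longrightarrow> sized u \<Longrightarrow> x \<in> carrier_vec n \<Longrightarrow> \<mu> \<bullet> (scaled_product n A u t *\<^sub>v x) = (\<Sum>i<n. ph u t $ i * x $ i)"
proof (induction t arbitrary: x)
  case 0
  thus ?case by (simp add: scalar_prod_def atLeast0LessThan)
next
  case (Suc t)
  have ut: "u t \<in> carrier_vec n" using Suc.prems by simp
  have D: "diag_of (u t) \<in> carrier_mat n n"
    using ut unfolding diag_of_def by (auto simp: carrier_vecD)
  have At: "A t \<in> carrier_mat n n" using A_carrier Suc.prems by simp
  have P: "scaled_product n A u t \<in> carrier_mat n n" using scaled_product_carrier Suc.prems by simp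
  have Ax: "A t *\<^sub>v x \<in> carrier_vec n" using At by simp
  have "scaled_product n A u (Suc t) *\<^sub>v x = (scaled_product n A u t * diag_of (u t)) *\<^sub>v (A t *\<^sub>v x)"
    using P D At Suc.prems(3) by (simp add: assoc_mult_mat_vec[of _ n n _ n])
  also have "\<dots> = scaled_product n A u t *\<^sub>v (diag_of (u t) *\<^sub>v (A t *\<^sub>v x))"
    using P D Ax by (rule assoc_mult_mat_vec)
  finally have "\<mu> \<bullet> (scaled_product n A u (Suc t) *\<^sub>v x) =
      (\<Sum>j<n. ph u t $ j * (diag_of (u t) *\<^sub>v (A t *\<^sub>v x)) $ j)"
    using Suc D by simp
  also have "\<dots> = (\<Sum>j<n. ph u t $ j * (u t $ j * (\<Sum>i<n. A t $$ (j, i) * x $ i)))"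
  proof (intro sum.cong refl arg_cong2[of _ _ _ _ "(*)"])
    fix j assume "j \<in> {..<n}"
    hence j: "j < n" by simp
    have "(diag_of (u t) *\<^sub>v (A t *\<^sub>v x)) $ j = (\<Sum>i<n. if i = j then u t $ i * (A t *\<^sub>v x) $ i else 0)"
      unfolding mult_mat_vec_index[OF D Ax j] using ut j
      by (intro sum.cong) (auto simp: diag_of_def mat_diag_def carrier_vecD simp del: index_mult_mat_vec)
    also have "\<dots> = u t $ j * (A t *\<^sub>v x) $ j" using j by (simp del: index_mult_mat_vec)
    finally show "(diag_of (u t) *\<^sub>v (A t *\<^sub>v x)) $ j = u t $ j * (\<Sum>i<n. A t $$ (j, i) * x $ i)"
      by (simp only: mult_mat_vec_index[OF At Suc.prems(3) j])
  qed
  also have "\<dots> = (\<Sum>j<n. \<Sum>i<n. A t $$ (j, i) * (ph u t $ j * u t $ j) * x $ i)"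
    by (simp add: sum_distrib_left mult_ac)
  also have "\<dots> = (\<Sum>i<n. ph u (Suc t) $ i * x $ i)"
    using Suc.prems by (subst sum.swap) (simp add: phi_hat_index sum_distrib_right del: phi_hat.simps)
  finally show ?case .
qed

lemma dual_objective_eq:
  "dual_objective T A C \<mu> \<rho> lam = (\<Sum>t\<le>T. lam t \<bullet> \<rho> t) - total (scaling C lam)"
  unfolding dual_objective_def total_def
  using scaled_product_scalar[OF order.refl scaling_sized scaling_carrier] by simp

subsection \<open>Block maximization and the algorithm\<close>

text \<open>The denominator of the update: the observed marginal with the factor \<open>u t\<close>
  left out.\<close>

definition marg :: "(nat \<Rightarrow> real vec) \<Rightarrow> nat \<Rightarrow> nat \<Rightarrow> real" where
  "marg u t j = pf u t $ (\<pi> ! j) * ph u t $ (\<pi> ! j)"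

lemma marg_update: "t \<le> T \<Longrightarrow> marg (u(t := v)) t j = marg u t j"
  unfolding marg_def using phi_cong[of t "u(t := v)" u] phi_hat_cong[of t "u(t := v)" u] by simp

lemma marg_scaling_pos:
  assumes "lam \<in> multipliers T k" "t \<le> T" "j < k"
  shows "0 < marg (scaling C lam) t j"
proof -
  have "0 \<le> marg (scaling C lam) t j"
    unfolding marg_def using assms by (intro mult_nonneg_nonneg phi_nonneg phi_hat_nonneg scaling_positive) auto
  thus ?thesis using division[OF assms] unfolding marg_def by linarith
qed

lemma multipliersD: "lam \<in> multipliers T k \<Longrightarrow> t \<le> T \<Longrightarrow> lam t \<in> carrier_vec k"
  unfolding multipliers_def by (auto simp: PiE_iff)

lemma multipliers_update:
  "lam \<in> multipliers T k \<Longrightarrow> t \<le> T \<Longrightarrow> x \<in> carrier_vec k \<Longrightarrow> lam(t := x) \<in> multipliers T k"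
  unfolding multipliers_def by (auto simp: PiE_iff extensional_def)

lemma multipliersI: "(\<And>t. t \<le> T \<Longrightarrow> f t \<in> carrier_vec k) \<Longrightarrow> restrict f {..T} \<in> multipliers T k"
  unfolding multipliers_def by auto

lemma sum_split_observed:
  "(\<Sum>i<n. f i) = (\<Sum>j<k. f (\<pi> ! j)) + (\<Sum>i\<in>{..<n} - set \<pi>. f i)" for f :: "nat \<Rightarrow> real"
proof -
  have "(\<Sum>i<n. f i) = (\<Sum>i\<in>set \<pi>. f i) + (\<Sum>i\<in>{..<n} - set \<pi>. f i)"
    using \<pi>_subset by (subst sum.subset_diff[of "set \<pi>"]) auto
  moreover have "bij_betw ((!) \<pi>) {..<k} (set \<pi>)"
    using distinct length_\<pi> by (intro bij_betw_nth) auto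
  ultimately show ?thesis by (simp add: sum.reindex_bij_betw)
qed

text \<open>By the pairing at time \<open>t\<close> the total mass is linear in the scaling of block
  \<open>t\<close>. Unobserved states have factor one and contribute only to the constant.\<close>

lemma block_objective:
  assumes "lam \<in> multipliers T k" "t \<le> T"
  shows "\<exists>Q. \<forall>y\<in>carrier_vec k. dual_objective T A C \<mu> \<rho> (lam(t := y)) =
    Q + (\<Sum>j<k. y $ j * \<rho> t $ j - exp (y $ j) * marg (scaling C lam) t j)"
proof (intro exI ballI)
  fix y :: "real vec" assume y: "y \<in> carrier_vec k"
  define u where "u = scaling C lam"
  define v where "v = scaling C (\<lambda>_. y) t"
  define u' where "u' = u(t := v)"
  have u': "scaling C (lam(t := y)) = u'" unfolding u'_def u_def v_def by (rule scaling_update)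
  have "sized u'" unfolding u'[symmetric] by (rule scaling_sized)
  hence "total u' = (\<Sum>i<n. ph u' t $ i * u' t $ i * pf u' t $ i)" using total_eq assms(2) by blast
  also have "\<dots> = (\<Sum>i<n. ph u t $ i * v $ i * pf u t $ i)"
    using phi_cong[of t u' u] phi_hat_cong[of t u' u] assms(2) by (simp add: u'_def)
  also have "\<dots> = (\<Sum>j<k. exp (y $ j) * marg u t j) + (\<Sum>i\<in>{..<n} - set \<pi>. ph u t $ i * pf u t $ i)"
    unfolding sum_split_observed using y by (simp add: v_def scaling_observed scaling_unobserved marg_def mult_ac)
  finally have total: "total u' = \<dots>" .
  have "(\<Sum>s\<le>T. (lam(t := y)) s \<bullet> \<rho> s) = y \<bullet> \<rho> t + (\<Sum>s\<in>{..T} - {t}. lam s \<bullet> \<rho> s)"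
    using assms(2) by (subst sum.remove[of _ t]) auto
  also have "y \<bullet> \<rho> t = (\<Sum>j<k. y $ j * \<rho> t $ j)"
    using carrier_vecD[OF \<rho>_carrier[OF assms(2)]] by (simp add: scalar_prod_def atLeast0LessThan)
  \<comment> \<open>The witness for \<open>Q\<close> is fixed here: the linear terms of the other
    blocks minus the mass of the unobserved states, none of which involves \<open>y\<close>.\<close>
  finally show "dual_objective T A C \<mu> \<rho> (lam(t := y)) =
      ((\<Sum>s\<in>{..T} - {t}. lam s \<bullet> \<rho> s) - (\<Sum>i\<in>{..<n} - set \<pi>. ph (scaling C lam) t $ i * pf (scaling C lam) t $ i))
      + (\<Sum>j<k. y $ j * \<rho> t $ j - exp (y $ j) * marg (scaling C lam) t j)"
    unfolding dual_objective_eq u' total by (simp add: sum_subtractf u_def)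
qed

text \<open>Concavity in the form of the tangent inequality for exp at zero, multiplied by
  \<open>r \<ge> 0\<close>: a stationary point is a global maximum.\<close>

lemma linear_minus_exp_maximum:
  fixes x y r d :: real
  assumes "exp x * d = r" "0 \<le> r"
  shows "y * r - exp y * d \<le> x * r - exp x * d"
proof -
  have "exp y * d = exp (y - x) * r" using assms by (simp add: exp_diff flip: assms(1))
  moreover have "(1 + (y - x)) * r \<le> exp (y - x) * r"
    using assms exp_ge_add_one_self by (intro mult_right_mono) auto
  ultimately show ?thesis using assms by (simp add: algebra_simps)
qed

text \<open>The block objective separates into one function per coordinate. Stationarity is
  sufficient by concavity and necessary because each coordinate may be varied alone. A zero mass
  makes both sides false, since \<open>marg\<close> is positive at scalings.\<close>

lemma block_maximizer_iff:
  assumes "lam \<in> multipliers T k" "t \<le> T" "x \<in> carrier_vec k"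
  shows "block_maximizer T A C \<mu> \<rho> lam t x \<longleftrightarrow> (\<forall>j<k. exp (x $ j) * marg (scaling C lam) t j = \<rho> t $ j)"
proof -
  let ?d = "marg (scaling C lam) t"
  let ?h = "\<lambda>j y. y * \<rho> t $ j - exp y * ?d j"
  obtain Q where Q: "\<forall>y\<in>carrier_vec k. dual_objective T A C \<mu> \<rho> (lam(t := y)) = Q + (\<Sum>j<k. ?h j (y $ j))"
    using block_objective[OF assms(1,2)] by blast
  have "block_maximizer T A C \<mu> \<rho> lam t x \<longleftrightarrow>
      (\<forall>y\<in>carrier_vec k. (\<Sum>j<k. ?h j (y $ j)) \<le> (\<Sum>j<k. ?h j (x $ j)))"
    using Q assms(3) by (auto simp: block_maximizer_def is_arg_max_def length_\<pi> not_less)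
  also have "\<dots> \<longleftrightarrow> (\<forall>j<k. exp (x $ j) * ?d j = \<rho> t $ j)"
  proof (intro iffI allI impI ballI)
    fix y :: "real vec" assume "\<forall>j<k. exp (x $ j) * ?d j = \<rho> t $ j"
    thus "(\<Sum>j<k. ?h j (y $ j)) \<le> (\<Sum>j<k. ?h j (x $ j))"
      using \<rho>_nonneg[OF assms(2)] by (intro sum_mono linear_minus_exp_maximum) auto
  next
    fix j assume max: "\<forall>y\<in>carrier_vec k. (\<Sum>j<k. ?h j (y $ j)) \<le> (\<Sum>j<k. ?h j (x $ j))" and j: "j < k"
    have "?h j z \<le> ?h j (x $ j)" for z
    proof -
      define y where "y = vec k (\<lambda>i. if i = j then z else x $ i)"
      have "(\<Sum>j<k. ?h j (y $ j)) \<le> (\<Sum>j<k. ?h j (x $ j))" using max by (rule bspec) (simp add: y_def)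
      moreover have "(\<Sum>j<k. ?h j (y $ j)) = ?h j z + (\<Sum>i\<in>{..<k} - {j}. ?h i (x $ i))"
        using j by (subst sum.remove[of _ j]) (auto simp: y_def intro!: sum.cong)
      moreover have "(\<Sum>j<k. ?h j (x $ j)) = ?h j (x $ j) + (\<Sum>i\<in>{..<k} - {j}. ?h i (x $ i))"
        using j by (intro sum.remove) auto
      ultimately show ?thesis by linarith
    qed
    moreover have "(?h j has_real_derivative (\<rho> t $ j - exp (x $ j) * ?d j)) (at (x $ j))"
      by (auto intro!: derivative_eq_intros)
    ultimately have "\<rho> t $ j - exp (x $ j) * ?d j = 0" by (intro DERIV_local_max[of "?h j" _ _ 1]) auto
    thus "exp (x $ j) * ?d j = \<rho> t $ j" by simp
  qed
  finally show ?thesis .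
qed

lemma C_marginal_index: "t \<le> T \<Longrightarrow> j < k \<Longrightarrow> (C *\<^sub>v (pf u t \<odot>\<^sub>v ph u t)) $ j = marg u t j"
  by (simp add: selection_mat_mult_index length_\<pi> marg_def carrier_vecD[OF phi_carrier] del: index_mult_mat_vec)

lemma complement_list:
  "set (sorted_list_of_set ({..<n} - set \<pi>)) = {..<n} - set \<pi>"
  "distinct (sorted_list_of_set ({..<n} - set \<pi>))"
  "length (sorted_list_of_set ({..<n} - set \<pi>)) = n - k"
  using \<pi>_subset distinct length_\<pi> by (auto simp: card_Diff_subset distinct_card)

lemma Cbar_mult:
  assumes "v \<in> carrier_vec n" "\<And>i. i < n \<Longrightarrow> i \<notin> set \<pi> \<Longrightarrow> v $ i = 1"
  shows "Cbar *\<^sub>v v = ones (n - k)"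
proof (rule eq_vecI)
  fix j assume "j < dim_vec (ones (n - k))"
  hence j: "j < length (sorted_list_of_set ({..<n} - set \<pi>))" by (simp only: dim_ones complement_list(3))
  hence "sorted_list_of_set ({..<n} - set \<pi>) ! j \<in> {..<n} - set \<pi>"
    using complement_list(1) nth_mem by blast
  thus "(Cbar *\<^sub>v v) $ j = ones (n - k) $ j"
    using assms j complement_list(3) by (subst selection_mat_mult_index) auto
qed (simp only: dim_mult_mat_vec selection_mat_dims dim_ones complement_list(3))

text \<open>Changing block \<open>t\<close> does not change its own denominators, which are
  positive, so the stationarity equations may be divided by them. The unobserved entries are
  exponentials of zero, hence one.\<close>

lemma block_maximizer_iff_scaling:
  assumes "lam \<in> multipliers T k" "t \<le> T" "x \<in> carrier_vec k"
  shows "block_maximizer T A C \<mu> \<rho> lam t x \<longleftrightarrow>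
    (let u = scaling C (lam(t := x)) in
      C *\<^sub>v u t = \<rho> t \<oslash>\<^sub>v (C *\<^sub>v (pf u t \<odot>\<^sub>v ph u t)) \<and> Cbar *\<^sub>v u t = ones (n - k))"
proof -
  define u where "u = scaling C (lam(t := x))"
  have cu: "marg u t j = marg (scaling C lam) t j" for j
    unfolding u_def scaling_update using assms(2) by (rule marg_update)
  have ut: "u t \<in> carrier_vec n" unfolding u_def by (rule scaling_carrier)
  have "Cbar *\<^sub>v u t = ones (n - k)"
    using ut assms(3) by (intro Cbar_mult) (simp_all add: u_def scaling_unobserved)
  moreover have "C *\<^sub>v u t = \<rho> t \<oslash>\<^sub>v (C *\<^sub>v (pf u t \<odot>\<^sub>v ph u t)) \<longleftrightarrow>
      (\<forall>j<k. exp (x $ j) = \<rho> t $ j / marg (scaling C lam) t j)"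
  proof -
    have "C *\<^sub>v u t = \<rho> t \<oslash>\<^sub>v (C *\<^sub>v (pf u t \<odot>\<^sub>v ph u t)) \<longleftrightarrow>
        (\<forall>j<k. (C *\<^sub>v u t) $ j = (\<rho> t \<oslash>\<^sub>v (C *\<^sub>v (pf u t \<odot>\<^sub>v ph u t))) $ j)"
      using carrier_vecD[OF \<rho>_carrier[OF assms(2)]] by (auto simp: vec_eq_iff length_\<pi>)
    moreover have "(C *\<^sub>v u t) $ j = exp (x $ j)" if "j < k" for j
      using ut that assms(3) by (simp add: selection_mat_mult_index length_\<pi> u_def scaling_observed del: index_mult_mat_vec)
    moreover have "(\<rho> t \<oslash>\<^sub>v (C *\<^sub>v (pf u t \<odot>\<^sub>v ph u t))) $ j = \<rho> t $ j / marg (scaling C lam) t j" if "j < k" for j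
      using that carrier_vecD[OF \<rho>_carrier[OF assms(2)]] assms(2)
      by (simp add: C_marginal_index cu del: index_mult_mat_vec)
    ultimately show ?thesis by simp
  qed
  moreover have "exp (x $ j) = \<rho> t $ j / marg (scaling C lam) t j \<longleftrightarrow> exp (x $ j) * marg (scaling C lam) t j = \<rho> t $ j"
    if "j < k" for j
    using marg_scaling_pos[OF assms(1,2) that] by (simp add: field_simps)
  ultimately show ?thesis unfolding block_maximizer_iff[OF assms] u_def[symmetric] Let_def by simp
qed

section \<open>The algorithm as an iteration of sweeps\<close>

definition update_vec :: "nat \<Rightarrow> (nat \<Rightarrow> real vec) \<Rightarrow> real vec" where
  "update_vec t u = transpose_mat C *\<^sub>v (\<rho> t \<oslash>\<^sub>v (C *\<^sub>v (pf u t \<odot>\<^sub>v ph u t)))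
     + transpose_mat Cbar *\<^sub>v (Cbar *\<^sub>v ones n)"

definition block_update :: "nat \<Rightarrow> (nat \<Rightarrow> real vec) \<Rightarrow> nat \<Rightarrow> real vec" where
  "block_update t u = u(t := update_vec t u)"

definition sweep :: "(nat \<Rightarrow> real vec) \<Rightarrow> nat \<Rightarrow> real vec" where
  "sweep = fold block_update [0..<Suc T]"

lemma update_vec_carrier: "update_vec t u \<in> carrier_vec n"
  unfolding update_vec_def by (intro add_carrier_vec transpose_mult_carrier[OF selection_mat_carrier])

lemma update_vec_observed:
  assumes "t \<le> T" "j < k"
  shows "update_vec t u $ (\<pi> ! j) = \<rho> t $ j / marg u t j"
proof -
  have r: "\<rho> t \<oslash>\<^sub>v (C *\<^sub>v (pf u t \<odot>\<^sub>v ph u t)) \<in> carrier_vec (length \<pi>)"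
    using \<rho>_carrier[OF assms(1)] length_\<pi> by simp
  have o: "Cbar *\<^sub>v ones n \<in> carrier_vec (length (sorted_list_of_set ({..<n} - set \<pi>)))"
    by (rule mult_mat_vec_carrier'[OF selection_mat_carrier])
  have "\<pi> ! j \<notin> set (sorted_list_of_set ({..<n} - set \<pi>))"
    using assms length_\<pi> unfolding complement_list by simp
  thus ?thesis
    using assms length_\<pi> carrier_vecD[OF \<rho>_carrier[OF assms(1)]]
    unfolding update_vec_def
    by (simp add: selection_mat_transpose_mult_unselected[OF o] selection_mat_transpose_mult_selected[OF r distinct]
        C_marginal_index del: index_mult_mat_vec)
qed

lemma update_vec_unobserved:
  assumes "t \<le> T" "i < n" "i \<notin> set \<pi>"
  shows "update_vec t u $ i = 1"
proof -
  let ?xs = "sorted_list_of_set ({..<n} - set \<pi>)"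
  have r: "\<rho> t \<oslash>\<^sub>v (C *\<^sub>v (pf u t \<odot>\<^sub>v ph u t)) \<in> carrier_vec (length \<pi>)"
    using \<rho>_carrier[OF assms(1)] length_\<pi> by simp
  have o: "Cbar *\<^sub>v ones n \<in> carrier_vec (length ?xs)"
    by (rule mult_mat_vec_carrier'[OF selection_mat_carrier])
  have "i \<in> set ?xs" using assms unfolding complement_list by simp
  then obtain j where j: "j < length ?xs" "?xs ! j = i" unfolding in_set_conv_nth by blast
  have "Cbar *\<^sub>v ones n = ones (n - k)" by (intro Cbar_mult) auto
  hence "(transpose_mat Cbar *\<^sub>v (Cbar *\<^sub>v ones n)) $ i = 1"
    using selection_mat_transpose_mult_selected[OF o complement_list(2) j(1)] j assms(2) complement_list(3) by simp
  thus ?thesis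
    using assms unfolding update_vec_def
    by (simp add: selection_mat_transpose_mult_unselected[OF r] del: index_mult_mat_vec)
qed

lemma vec_eq_by_observation:
  assumes "v \<in> carrier_vec n" "w \<in> carrier_vec n"
    and "\<And>j. j < k \<Longrightarrow> v $ (\<pi> ! j) = w $ (\<pi> ! j)"
    and "\<And>i. i < n \<Longrightarrow> i \<notin> set \<pi> \<Longrightarrow> v $ i = w $ i"
  shows "v = w"
proof (rule eq_vecI)
  fix i assume "i < dim_vec w"
  hence "i < n" using assms(2) by simp
  thus "v $ i = w $ i"
    using assms(3,4) length_\<pi> by (cases "i \<in> set \<pi>") (auto simp: in_set_conv_nth)
qed (use assms in auto)

lemma block_update_scaling:
  assumes "lam \<in> multipliers T k" "t \<le> T" "x \<in> carrier_vec k" "block_maximizer T A C \<mu> \<rho> lam t x"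
  shows "block_update t (scaling C lam) = scaling C (lam(t := x))"
proof -
  have "update_vec t (scaling C lam) = scaling C (\<lambda>_. x) t"
  proof (rule vec_eq_by_observation[OF update_vec_carrier scaling_carrier])
    fix j assume j: "j < k"
    have "exp (x $ j) * marg (scaling C lam) t j = \<rho> t $ j"
      using assms j block_maximizer_iff by blast
    thus "update_vec t (scaling C lam) $ (\<pi> ! j) = scaling C (\<lambda>_. x) t $ (\<pi> ! j)"
      using j assms marg_scaling_pos[OF assms(1,2) j]
      by (simp add: update_vec_observed scaling_observed field_simps)
  qed (use assms in \<open>simp add: update_vec_unobserved scaling_unobserved\<close>)
  thus ?thesis unfolding block_update_def scaling_update by simp
qed

text \<open>Loop invariant before the forward step at \<open>r\<close>: the forward array is valid
  up to \<open>r\<close> and the backward array from \<open>r\<close> on. The value at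
  \<open>T\<close> is listed separately, since at \<open>r = Suc T\<close> the second range is
  empty.\<close>

fun consistent_from :: "nat \<Rightarrow> alg_state \<Rightarrow> bool" where
  "consistent_from r (u, fh, f) \<longleftrightarrow>
     (\<forall>s\<le>r. s \<le> T \<longrightarrow> fh s = ph u s) \<and> (\<forall>s. r \<le> s \<and> s \<le> T \<longrightarrow> f s = pf u s) \<and> f T = ones n"

text \<open>A new block \<open>t\<close> affects forward messages only after \<open>t\<close> and
  backward messages only before \<open>t\<close>. The forward entry at \<open>Suc t\<close> is
  recomputed, and the stale backward entries are not read again in this pass.\<close>

lemma forward_step_consistent:
  assumes "consistent_from t (u, fh, f)" "t \<le> T"
  obtains fh' where "forward_step T A C Cbar \<rho> t (u, fh, f) = (block_update t u, fh', f)"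
    "consistent_from (Suc t) (block_update t u, fh', f)"
proof -
  define fh' where "fh' = (if t < T then fh(Suc t := transpose_mat (A t) *\<^sub>v (fh t \<odot>\<^sub>v update_vec t u)) else fh)"
  have fht: "fh t = ph u t" "f t = pf u t" using assms by auto
  have step: "forward_step T A C Cbar \<rho> t (u, fh, f) = (block_update t u, fh', f)"
    by (simp add: block_update_def update_vec_def fh'_def fht Let_def)
  have h: "ph (block_update t u) s = ph u s" if "s \<le> t" for s
    using that by (intro phi_hat_cong) (auto simp: block_update_def)
  have f: "pf (block_update t u) s = pf u s" if "t \<le> s" "s \<le> T" for s
    using that by (intro phi_cong) (auto simp: block_update_def)
  have "fh' s = ph (block_update t u) s" if "s \<le> Suc t" "s \<le> T" for s
  proof (cases "s = Suc t")
    case True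
    thus ?thesis using that h[of t] by (simp add: fh'_def fht block_update_def)
  next
    case False
    thus ?thesis using that h[of s] assms by (auto simp: fh'_def)
  qed
  moreover have "f s = pf (block_update t u) s" if "Suc t \<le> s" "s \<le> T" for s
    using that f[of s] assms by auto
  ultimately have "consistent_from (Suc t) (block_update t u, fh', f)" using assms by auto
  thus ?thesis using that step by blast
qed

lemma forward_pass_consistent:
  assumes "consistent_from 0 (u, fh, f)"
  obtains fh' where "forward_pass T A C Cbar \<rho> (u, fh, f) = (sweep u, fh', f)" "fh' 0 = \<mu>"
proof -
  have "\<exists>fh'. fold (forward_step T A C Cbar \<rho>) [0..<r] (u, fh, f) = (fold block_update [0..<r] u, fh', f) \<and>
      consistent_from r (fold block_update [0..<r] u, fh', f)" if "r \<le> Suc T" for r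
    using that
  proof (induction r)
    case 0
    show ?case using assms by auto
  next
    case (Suc r)
    then obtain fh' where fh': "fold (forward_step T A C Cbar \<rho>) [0..<r] (u, fh, f) = (fold block_update [0..<r] u, fh', f)"
      "consistent_from r (fold block_update [0..<r] u, fh', f)" by auto
    obtain fh'' where "forward_step T A C Cbar \<rho> r (fold block_update [0..<r] u, fh', f) = (block_update r (fold block_update [0..<r] u), fh'', f)"
      "consistent_from (Suc r) (block_update r (fold block_update [0..<r] u), fh'', f)"
      using forward_step_consistent[OF fh'(2)] Suc.prems by auto
    thus ?case using fh'(1) by (auto simp del: consistent_from.simps forward_step.simps)
  qed
  from this[of "Suc T"] show ?thesis using that unfolding forward_pass_def sweep_def by auto
qed

lemma backward_pass_consistent:
  assumes "f T = ones n"
  obtains f' where "backward_pass T A (u, fh, f) = (u, fh, f')" "\<And>s. s \<le> T \<Longrightarrow> f' s = pf u s"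
proof -
  \<comment> \<open>The loop runs downwards, so \<open>r\<close> counts the entries still to be
    recomputed; the array is arbitrary below \<open>r\<close> and correct from \<open>r\<close>
    on.\<close>
  have "\<exists>f'. fold (backward_step A) (rev [0..<r]) (u, fh, f) = (u, fh, f') \<and> (\<forall>s\<le>T. f' s = pf u s)"
    if "r \<le> T" "\<forall>s. r \<le> s \<and> s \<le> T \<longrightarrow> f s = pf u s" for r f
    using that
  proof (induction r arbitrary: f)
    case (Suc r)
    define g where "g = f(r := A r *\<^sub>v (u (Suc r) \<odot>\<^sub>v f (Suc r)))"
    have "\<forall>s. r \<le> s \<and> s \<le> T \<longrightarrow> g s = pf u s"
      using Suc.prems by (auto simp: g_def phi_Suc)
    moreover have "backward_step A r (u, fh, f) = (u, fh, g)" by (simp add: g_def)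
    ultimately show ?case using Suc.IH[of g] Suc.prems(1) by simp
  qed auto
  moreover have "\<forall>s. T \<le> s \<and> s \<le> T \<longrightarrow> f s = pf u s"
    using assms by (metis phi_T le_antisym order_refl)
  ultimately show ?thesis using that unfolding backward_pass_def by blast
qed

text \<open>Both message arrays hold the messages of the current \<open>u\<close> wherever they are
  read, so only \<open>u\<close> has to be followed. A sweep may begin from any state satisfying
  \<open>consistent_from 0\<close>, which the backward pass restores.\<close>

lemma alg_u_eq: "alg_u T A C Cbar \<mu> \<rho> u m = (sweep ^^ m) u"
proof -
  have "\<exists>fh f. ((backward_pass T A \<circ> forward_pass T A C Cbar \<rho>) ^^ m) (alg_init T A C \<mu> u) =
      ((sweep ^^ m) u, fh, f) \<and> consistent_from 0 ((sweep ^^ m) u, fh, f)"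
  proof (induction m)
    case 0
    obtain f where "backward_pass T A (u, \<lambda>_. \<mu>, \<lambda>_. ones n) = (u, \<lambda>_. \<mu>, f)" "\<And>s. s \<le> T \<Longrightarrow> f s = pf u s"
      using backward_pass_consistent[of "\<lambda>_. ones n" u "\<lambda>_. \<mu>"] by auto
    thus ?case by (auto simp: alg_init_def phi_T)
  next
    case (Suc m)
    then obtain fh f where st: "((backward_pass T A \<circ> forward_pass T A C Cbar \<rho>) ^^ m) (alg_init T A C \<mu> u) =
      ((sweep ^^ m) u, fh, f)" "consistent_from 0 ((sweep ^^ m) u, fh, f)" by blast
    obtain fh' where fh': "forward_pass T A C Cbar \<rho> ((sweep ^^ m) u, fh, f) = (sweep ((sweep ^^ m) u), fh', f)" "fh' 0 = \<mu>"
      using forward_pass_consistent[OF st(2)] by blast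
    obtain f' where "backward_pass T A (sweep ((sweep ^^ m) u), fh', f) = (sweep ((sweep ^^ m) u), fh', f')"
        "\<And>s. s \<le> T \<Longrightarrow> f' s = pf (sweep ((sweep ^^ m) u)) s"
      using backward_pass_consistent[of f "sweep ((sweep ^^ m) u)" fh'] st(2) by auto
    note f' = this
    have "((backward_pass T A \<circ> forward_pass T A C Cbar \<rho>) ^^ Suc m) (alg_init T A C \<mu> u) =
        backward_pass T A (forward_pass T A C Cbar \<rho>
          (((backward_pass T A \<circ> forward_pass T A C Cbar \<rho>) ^^ m) (alg_init T A C \<mu> u)))"
      by (simp only: funpow.simps o_apply)
    also have "\<dots> = ((sweep ^^ Suc m) u, fh', f')"
      by (simp only: st(1) fh'(1) f'(1) funpow.simps o_apply)
    moreover have "consistent_from 0 ((sweep ^^ Suc m) u, fh', f')" using f'(2) fh'(2) by (simp add: phi_T)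
    ultimately show ?case by metis
  qed
  thus ?thesis unfolding alg_u_def by auto
qed

section \<open>Block coordinate ascent in terms of sweeps\<close>

abbreviation ascent where "ascent \<equiv> block_coordinate_ascent T A C \<mu> \<rho>"

lemma block_maximizer_carrier: "block_maximizer T A C \<mu> \<rho> lam t x \<Longrightarrow> x \<in> carrier_vec k"
  by (simp add: block_maximizer_def is_arg_max_def length_\<pi>)

lemma ascent_multipliers: "ascent L \<Longrightarrow> L N \<in> multipliers T k"
proof (induction N)
  case 0
  thus ?case by (simp add: block_coordinate_ascent_def length_\<pi>)
next
  case (Suc N)
  obtain x where "block_maximizer T A C \<mu> \<rho> (L N) (N mod Suc T) x" "L (Suc N) = (L N)(N mod Suc T := x)"
    using Suc.prems unfolding block_coordinate_ascent_def by blast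
  moreover have "N mod Suc T \<le> T" using mod_less_divisor[of "Suc T" N] by linarith
  ultimately show ?case using multipliers_update[OF Suc.IH[OF Suc.prems]] block_maximizer_carrier by metis
qed

lemma ascent_step:
  assumes "ascent L"
  obtains x where "x \<in> carrier_vec k" "block_maximizer T A C \<mu> \<rho> (L N) (N mod Suc T) x"
    "L (Suc N) = (L N)(N mod Suc T := x)" "N mod Suc T \<le> T"
proof -
  have "N mod Suc T \<le> T" using mod_less_divisor[of "Suc T" N] by linarith
  thus ?thesis using that assms block_maximizer_carrier unfolding block_coordinate_ascent_def by blast
qed

lemma sweep_power_scaling:
  assumes L: "ascent L"
  shows "(sweep ^^ m) (scaling C (L 0)) = scaling C (L (m * Suc T))"
proof (induction m)
  case (Suc m)
  have "fold block_update [0..<r] (scaling C (L (m * Suc T))) = scaling C (L (m * Suc T + r))" if "r \<le> Suc T" for r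
    using that
  proof (induction r)
    case (Suc r)
    obtain x where x: "x \<in> carrier_vec k"
      "block_maximizer T A C \<mu> \<rho> (L (m * Suc T + r)) ((m * Suc T + r) mod Suc T) x"
      "L (Suc (m * Suc T + r)) = (L (m * Suc T + r))((m * Suc T + r) mod Suc T := x)"
      using ascent_step[OF L] by blast
    \<comment> \<open>A sweep starts at a multiple of \<open>Suc T\<close>, so its step
      \<open>r\<close> treats block \<open>r\<close>.\<close>
    have "(m * Suc T + r) mod Suc T = r" using Suc.prems by (metis mod_less mod_mult_self3 less_Suc_eq_le Suc_le_mono)
    hence "block_update r (scaling C (L (m * Suc T + r))) = scaling C (L (Suc (m * Suc T + r)))"
      using x block_update_scaling[OF ascent_multipliers[OF L], of r x] Suc.prems by simp
    thus ?case using Suc by simp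
  qed simp
  from this[of "Suc T"] Suc show ?case by (simp add: sweep_def add_ac)
qed simp

subsection \<open>Convergence\<close>

definition coords :: "(nat \<times> nat) set" where
  "coords = {..T} \<times> {..<k}"

text \<open>Incidence of a path with an observed state at a given time; it becomes the coefficient
  \<open>a\<close> of \<open>cyclic_scaling\<close>.\<close>

definition visits :: "(nat \<Rightarrow> nat) \<Rightarrow> nat \<times> nat \<Rightarrow> real" where
  "visits p = (\<lambda>(t, j). of_bool (\<pi> ! j = p t))"

text \<open>Paths of weight zero have no mass under any scaling, and leaving them out gives the
  positivity that \<open>cyclic_scaling\<close> requires.\<close>

definition support :: "(nat \<Rightarrow> nat) set" where
  "support = {p \<in> paths. 0 < path_weight p}"

definition path_mass :: "(nat \<Rightarrow> real vec) \<Rightarrow> (nat \<Rightarrow> nat) \<Rightarrow> real" where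
  "path_mass u p = path_weight p * (\<Prod>t\<le>T. u t $ p t)"

lemma finite_support: "finite support"
  unfolding support_def using finite_paths by simp

lemma path_mass_pos: "p \<in> support \<Longrightarrow> positive u \<Longrightarrow> 0 < path_mass u p"
  unfolding path_mass_def support_def
  by (auto simp: positive_def path_less intro!: mult_pos_pos prod_pos)

lemma sum_paths_support: "(\<Sum>p\<in>paths. f p * path_mass u p) = (\<Sum>p\<in>support. f p * path_mass u p)"
  unfolding support_def using finite_paths path_weight_nonneg
  by (intro sum.mono_neutral_right) (auto simp: path_mass_def order_less_le)

lemma total_support: "total u = (\<Sum>p\<in>support. path_mass u p)"
  using sum_paths_support[of "\<lambda>_. 1" u] by (simp add: total_path_sum path_mass_def)

lemma marginal_support:
  assumes "t \<le> T" "sized u" "j < k"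
  shows "u t $ (\<pi> ! j) * marg u t j = (\<Sum>p\<in>support. visits p (t, j) * path_mass u p)"
proof -
  have "u t $ (\<pi> ! j) * marg u t j = (\<Sum>p\<in>paths. visits p (t, j) * path_mass u p)"
    using marginal_path_sum[OF assms(1,2) \<pi>_less[OF assms(3)]]
    by (simp add: marg_def visits_def path_mass_def mult_ac eq_commute)
  thus ?thesis by (simp only: sum_paths_support)
qed

text \<open>The scaling at state \<open>p t\<close> is the exponential of its multiplier if the
  state is observed and one otherwise; the sum over incidences covers both cases.\<close>

lemma path_mass_scaling:
  assumes "lam \<in> multipliers T k" "p \<in> paths"
  shows "path_mass (scaling C lam) p = path_weight p * exp (\<Sum>(t, j)\<in>coords. visits p (t, j) * lam t $ j)"
proof -
  have "scaling C lam t $ p t = exp (\<Sum>j<k. visits p (t, j) * lam t $ j)" if "t \<in> {..T}" for t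
    using that multipliersD[OF assms(1), of t] path_less[OF assms(2), of t]
    by (simp add: scaling_index selection_mat_transpose_mult_index length_\<pi> visits_def del: index_mult_mat_vec)
  hence "(\<Prod>t\<le>T. scaling C lam t $ p t) = exp (\<Sum>t\<le>T. \<Sum>j<k. visits p (t, j) * lam t $ j)"
    by (simp add: exp_sum)
  thus ?thesis by (simp add: path_mass_def coords_def sum.cartesian_product)
qed

lemma path_mass_ratio:
  assumes "lam \<in> multipliers T k" "lam' \<in> multipliers T k" "p \<in> paths"
  shows "path_mass (scaling C lam) p = path_mass (scaling C lam') p *
    exp (\<Sum>i\<in>coords. visits p i * (lam (fst i) $ snd i - lam' (fst i) $ snd i))"
  unfolding path_mass_scaling[OF assms(1,3)] path_mass_scaling[OF assms(2,3)] mult.assoc exp_add[symmetric]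
    sum.distrib[symmetric]
  by (intro arg_cong2[of _ _ _ _ "(*)"] arg_cong[of _ _ exp] sum.cong refl) (auto simp: algebra_simps)

lemma linear_part:
  "lam \<in> multipliers T k \<Longrightarrow> (\<Sum>t\<le>T. lam t \<bullet> \<rho> t) = (\<Sum>i\<in>coords. lam (fst i) $ snd i * \<rho> (fst i) $ snd i)"
  using carrier_vecD[OF \<rho>_carrier]
  by (simp add: coords_def scalar_prod_def atLeast0LessThan sum.cartesian_product case_prod_unfold)

section \<open>Consequences of the existence of a maximizer\<close>

context
  fixes ls
  assumes ls: "dual_maximizer T A C \<mu> \<rho> ls"
begin

lemma ls_multipliers: "ls \<in> multipliers T k"
  using ls by (simp add: dual_maximizer_def is_arg_max_def length_\<pi>)

lemma ls_block: "t \<le> T \<Longrightarrow> j < k \<Longrightarrow> exp (ls t $ j) * marg (scaling C ls) t j = \<rho> t $ j"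
proof -
  assume t: "t \<le> T" and j: "j < k"
  have x: "ls t \<in> carrier_vec k" using ls_multipliers t by (rule multipliersD)
  have "block_maximizer T A C \<mu> \<rho> ls t (ls t)"
    using ls x multipliers_update[OF ls_multipliers t]
    by (auto simp: block_maximizer_def dual_maximizer_def is_arg_max_def length_\<pi>)
  thus ?thesis using block_maximizer_iff[OF ls_multipliers t x] j by blast
qed

text \<open>Both factors in \<open>ls_block\<close> are positive. With a zero mass the objective
  would strictly increase whenever that multiplier decreases.\<close>

lemma \<rho>_pos: "t \<le> T \<Longrightarrow> j < k \<Longrightarrow> 0 < \<rho> t $ j"
  using marg_scaling_pos[OF ls_multipliers] by (simp flip: ls_block)

lemma \<rho>_marginal: "t \<le> T \<Longrightarrow> j < k \<Longrightarrow> (\<Sum>p\<in>support. visits p (t, j) * path_mass (scaling C ls) p) = \<rho> t $ j"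
  using marginal_support[OF _ scaling_sized, of t j ls] ls_block[of t j] multipliersD[OF ls_multipliers, of t]
  by (simp add: scaling_observed)

lemma visited: "t \<le> T \<Longrightarrow> j < k \<Longrightarrow> \<exists>p\<in>support. visits p (t, j) = 1"
proof (rule ccontr)
  assume tj: "t \<le> T" "j < k" and "\<not> (\<exists>p\<in>support. visits p (t, j) = 1)"
  hence "visits p (t, j) = 0" if "p \<in> support" for p using that by (auto simp: visits_def)
  hence "\<rho> t $ j = 0" using \<rho>_marginal[OF tj] by simp
  thus False using \<rho>_pos[OF tj] by simp
qed

text \<open>A positive \<open>u\<close> with arbitrary unobserved entries need not be a scaling, so
  \<open>division\<close> says nothing about it. A path of positive weight through the state serves
  instead.\<close>

lemma marg_pos:
  assumes "positive u" "t \<le> T" "j < k"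
  shows "0 < marg u t j"
proof -
  obtain p where p: "p \<in> support" "visits p (t, j) = 1" using visited assms by blast
  have "0 < visits p (t, j) * path_mass u p" using p path_mass_pos assms(1) by simp
  also have "\<dots> \<le> (\<Sum>p\<in>support. visits p (t, j) * path_mass u p)"
    using p(1) finite_support path_mass_pos[OF _ assms(1)]
    by (intro member_le_sum) (auto simp: visits_def less_imp_le)
  finally have "0 < u t $ (\<pi> ! j) * marg u t j"
    using marginal_support[OF assms(2) positive_sized[OF assms(1)] assms(3)] by simp
  moreover have "0 < u t $ (\<pi> ! j)" using assms by (simp add: positive_def)
  ultimately show ?thesis by (simp add: zero_less_mult_iff)
qed

lemma ascent_exists:
  assumes "lam \<in> multipliers T k"
  shows "\<exists>L. L 0 = lam \<and> ascent L"
proof -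
  have "\<exists>L. \<forall>N. (L N \<in> multipliers T k \<and> (N = 0 \<longrightarrow> L N = lam)) \<and>
      (\<exists>x. block_maximizer T A C \<mu> \<rho> (L N) (N mod Suc T) x \<and> L (Suc N) = (L N)(N mod Suc T := x))"
  proof (rule dependent_nat_choice)
    fix l and N :: nat assume "l \<in> multipliers T k \<and> (N = 0 \<longrightarrow> l = lam)"
    hence l: "l \<in> multipliers T k" by simp
    define t where "t = N mod Suc T"
    have t: "t \<le> T" using mod_less_divisor[of "Suc T" N] unfolding t_def by linarith
    \<comment> \<open>The stationarity equation solved by a logarithm; numerator and denominator are
      both positive.\<close>
    define x where "x = vec k (\<lambda>j. ln (\<rho> t $ j / marg (scaling C l) t j))"
    have x: "x \<in> carrier_vec k" by (simp add: x_def)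
    have "exp (x $ j) * marg (scaling C l) t j = \<rho> t $ j" if "j < k" for j
      using marg_scaling_pos[OF l t that] \<rho>_pos[OF t that] that by (simp add: x_def)
    hence "block_maximizer T A C \<mu> \<rho> l t x" using block_maximizer_iff[OF l t x] by blast
    thus "\<exists>l'. (l' \<in> multipliers T k \<and> (Suc N = 0 \<longrightarrow> l' = lam)) \<and>
        (\<exists>x. block_maximizer T A C \<mu> \<rho> l (N mod Suc T) x \<and> l' = l(N mod Suc T := x))"
      using multipliers_update[OF l t x] unfolding t_def by auto
  qed (use assms in auto)
  thus ?thesis unfolding block_coordinate_ascent_def by (auto simp: length_\<pi>)
qed

text \<open>Step \<open>N\<close> scales the coordinates of time \<open>N mod Suc T\<close>. A path
  is in one state at each time and the observed states are distinct, so it meets at most one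
  coordinate of a block; any \<open>Suc T\<close> consecutive steps treat every block.\<close>

lemma cyclic_scaling_ascent:
  assumes L: "ascent L"
  shows "cyclic_scaling support coords visits (path_mass (scaling C ls)) (\<lambda>N. {N mod Suc T} \<times> {..<k}) (Suc T)
    (\<lambda>N i. L N (fst i) $ snd i) (\<lambda>i. ls (fst i) $ snd i)"
proof
  show "finite support" "finite coords" by (simp_all add: finite_support coords_def)
  show "0 < path_mass (scaling C ls) p" if "p \<in> support" for p
    using that by (rule path_mass_pos[OF _ scaling_positive])
  have m: "N mod Suc T \<le> T" for N using mod_less_divisor[of "Suc T" N] by linarith
  show "{N mod Suc T} \<times> {..<k} \<subseteq> coords" for N using m by (auto simp: coords_def)
  show "i = i'" if "i \<in> {N mod Suc T} \<times> {..<k}" "i' \<in> {N mod Suc T} \<times> {..<k}"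
    "visits p i \<noteq> 0" "visits p i' \<noteq> 0" for p i i' N
    using that nth_eq_iff_index_eq[OF distinct] length_\<pi> by (auto simp: visits_def split: if_splits) metis
  show "\<bar>visits p i\<bar> \<le> 1" for p i by (simp add: visits_def case_prod_unfold)
  show "\<exists>p\<in>support. visits p i = 1" if "i \<in> coords" for i
    using that visited by (auto simp: coords_def)
  show "\<exists>r<Suc T. i \<in> {(N + r) mod Suc T} \<times> {..<k}" if "i \<in> coords" for i N
  proof -
    obtain t j where i: "i = (t, j)" "t \<le> T" "j < k" using \<open>i \<in> coords\<close> by (auto simp: coords_def)
    \<comment> \<open>The number of steps from \<open>N\<close> until block \<open>t\<close> is
      treated, zero if step \<open>N\<close> does so; the subtraction is exact since the remainder
      is at most \<open>T\<close>.\<close>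
    define r where "r = (t + (Suc T - N mod Suc T)) mod Suc T"
    have "(N + r) mod Suc T = (N mod Suc T + (t + (Suc T - N mod Suc T))) mod Suc T"
      unfolding r_def by (metis mod_add_left_eq mod_add_right_eq)
    also have "N mod Suc T + (t + (Suc T - N mod Suc T)) = t + Suc T" using m[of N] by linarith
    also have "\<dots> mod Suc T = t" using i(2) by (simp only: mod_add_self2 mod_less less_Suc_eq_le)
    finally have "i \<in> {(N + r) mod Suc T} \<times> {..<k}" using i by simp
    moreover have "r < Suc T" unfolding r_def by simp
    ultimately show ?thesis by blast
  qed
  show "L (Suc N) (fst i) $ snd i = L N (fst i) $ snd i" if "i \<in> coords" "i \<notin> {N mod Suc T} \<times> {..<k}" for i N
  proof -
    obtain x where "L (Suc N) = (L N)(N mod Suc T := x)" using ascent_step[OF L, of N] by blast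
    moreover have "fst i \<noteq> N mod Suc T" using that by (cases i) (auto simp: coords_def)
    ultimately show ?thesis by simp
  qed
  show "(\<Sum>p\<in>support. visits p i * (path_mass (scaling C ls) p *
          exp (\<Sum>i\<in>coords. visits p i * (L (Suc N) (fst i) $ snd i - ls (fst i) $ snd i)))) =
        (\<Sum>p\<in>support. visits p i * path_mass (scaling C ls) p)" if i: "i \<in> {N mod Suc T} \<times> {..<k}" for i N
  proof -
    obtain t j where tj: "i = (t, j)" "t = N mod Suc T" "t \<le> T" "j < k" using i m by auto
    obtain x where x: "x \<in> carrier_vec k" "block_maximizer T A C \<mu> \<rho> (L N) t x" "L (Suc N) = (L N)(t := x)"
      using ascent_step[OF L, of N] unfolding tj(2) by blast
    have "exp (x $ j) * marg (scaling C (L N)) t j = \<rho> t $ j"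
      using block_maximizer_iff[OF ascent_multipliers[OF L] tj(3) x(1)] x(2) tj(4) by blast
    \<comment> \<open>The denominators of block \<open>t\<close> are the same before and after the
      step, so stationarity becomes the marginal equation at \<open>L (Suc N)\<close>.\<close>
    hence "scaling C (L (Suc N)) t $ (\<pi> ! j) * marg (scaling C (L (Suc N))) t j = \<rho> t $ j"
      using tj x(1) by (simp add: x(3) scaling_observed) (simp add: scaling_update marg_update)
    hence "(\<Sum>p\<in>support. visits p i * path_mass (scaling C (L (Suc N))) p) = \<rho> t $ j"
      using marginal_support[OF tj(3) scaling_sized tj(4)] tj(1) by simp
    moreover have "path_mass (scaling C (L (Suc N))) p = path_mass (scaling C ls) p *
          exp (\<Sum>i\<in>coords. visits p i * (L (Suc N) (fst i) $ snd i - ls (fst i) $ snd i))"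
      if "p \<in> support" for p
      using that by (intro path_mass_ratio ascent_multipliers[OF L] ls_multipliers) (simp add: support_def)
    ultimately show ?thesis using \<rho>_marginal[OF tj(3,4)] tj(1) by simp
  qed
qed

text \<open>The exponents relative to \<open>ls\<close> vanish, so the path masses and their total
  agree. The linear parts agree as well because \<rho> is a combination of incidence vectors of
  supported paths, with the masses at \<open>ls\<close> as coefficients.\<close>

lemma dual_maximizer_if_same_masses:
  assumes lam: "lam \<in> multipliers T k"
    and eq: "\<And>p. p \<in> support \<Longrightarrow> (\<Sum>i\<in>coords. visits p i * (lam (fst i) $ snd i - ls (fst i) $ snd i)) = 0"
  shows "dual_maximizer T A C \<mu> \<rho> lam"
proof -
  have "total (scaling C lam) = total (scaling C ls)"
    unfolding total_support
  proof (rule sum.cong[OF refl])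
    fix p assume p: "p \<in> support"
    hence "p \<in> paths" by (simp add: support_def)
    thus "path_mass (scaling C lam) p = path_mass (scaling C ls) p"
      using path_mass_ratio[OF lam ls_multipliers] eq[OF p] by simp
  qed
  moreover have "(\<Sum>t\<le>T. lam t \<bullet> \<rho> t) = (\<Sum>t\<le>T. ls t \<bullet> \<rho> t)"
  proof -
    let ?d = "\<lambda>i. lam (fst i) $ snd i - ls (fst i) $ snd i"
    have "(\<Sum>t\<le>T. lam t \<bullet> \<rho> t) - (\<Sum>t\<le>T. ls t \<bullet> \<rho> t) = (\<Sum>i\<in>coords. ?d i * \<rho> (fst i) $ snd i)"
      unfolding linear_part[OF lam] linear_part[OF ls_multipliers]
      by (simp add: sum_subtractf left_diff_distrib)
    also have "\<dots> = (\<Sum>i\<in>coords. ?d i * (\<Sum>p\<in>support. visits p i * path_mass (scaling C ls) p))"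
    proof (rule sum.cong[OF refl])
      fix i assume "i \<in> coords"
      hence "(\<Sum>p\<in>support. visits p i * path_mass (scaling C ls) p) = \<rho> (fst i) $ snd i"
        using \<rho>_marginal[of "fst i" "snd i"] by (auto simp: coords_def)
      thus "?d i * \<rho> (fst i) $ snd i = ?d i * (\<Sum>p\<in>support. visits p i * path_mass (scaling C ls) p)" by simp
    qed
    also have "\<dots> = (\<Sum>p\<in>support. path_mass (scaling C ls) p * (\<Sum>i\<in>coords. visits p i * ?d i))"
      unfolding sum_distrib_left by (subst sum.swap) (simp add: mult_ac)
    also have "\<dots> = 0" by (simp add: eq)
    finally show ?thesis by simp
  qed
  ultimately have "dual_objective T A C \<mu> \<rho> lam = dual_objective T A C \<mu> \<rho> ls"
    by (simp add: dual_objective_eq)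
  thus ?thesis using ls lam by (simp add: dual_maximizer_def is_arg_max_def length_\<pi>)
qed

text \<open>Coordinatewise limits exist by the abstract iteration, and since the tilts tend to zero,
  the limit has the path masses of \<open>ls\<close>. It may differ from \<open>ls\<close>
  itself.\<close>

lemma ascent_converges:
  assumes L: "ascent L"
  shows "\<exists>lam. dual_maximizer T A C \<mu> \<rho> lam \<and> multipliers_converge T k L lam"
proof -
  interpret cyclic_scaling support coords visits "path_mass (scaling C ls)" "\<lambda>N. {N mod Suc T} \<times> {..<k}" "Suc T"
    "\<lambda>N i. L N (fst i) $ snd i" "\<lambda>i. ls (fst i) $ snd i"
    by (rule cyclic_scaling_ascent[OF L])
  define lam where "lam = restrict (\<lambda>t. vec k (\<lambda>j. lim (\<lambda>N. L N t $ j))) {..T}"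
  have lam: "lam \<in> multipliers T k" unfolding lam_def by (rule multipliersI) simp
  have conv: "(\<lambda>N. L N (fst i) $ snd i) \<longlonglongrightarrow> lam (fst i) $ snd i" if "i \<in> coords" for i
    using convergent_iterates[OF that] that by (auto simp: lam_def coords_def convergent_LIMSEQ_iff)
  have "(\<Sum>i\<in>coords. visits p i * (lam (fst i) $ snd i - ls (fst i) $ snd i)) = 0" if p: "p \<in> support" for p
  proof (rule LIMSEQ_unique)
    show "(\<lambda>N. tilt N p) \<longlonglongrightarrow> (\<Sum>i\<in>coords. visits p i * (lam (fst i) $ snd i - ls (fst i) $ snd i))"
      unfolding tilt_def by (intro tendsto_intros conv)
  qed (rule tilt_tendsto_0[OF p])
  hence "dual_maximizer T A C \<mu> \<rho> lam" by (rule dual_maximizer_if_same_masses[OF lam])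
  moreover have "multipliers_converge T k L lam"
    using conv by (auto simp: multipliers_converge_def coords_def)
  ultimately show ?thesis by blast
qed

text \<open>Each block update puts positive quotients at observed states and ones elsewhere, so a
  single sweep brings any positive start into the form of a scaling.\<close>

lemma sweep_positive:
  assumes "positive u"
  shows "positive (sweep u)" and "t \<le> T \<Longrightarrow> i < n \<Longrightarrow> i \<notin> set \<pi> \<Longrightarrow> sweep u t $ i = 1"
proof -
  have "positive (fold block_update [0..<r] u) \<and> (\<forall>t<r. \<forall>i<n. i \<notin> set \<pi> \<longrightarrow> fold block_update [0..<r] u t $ i = 1)"
    if "r \<le> Suc T" for r
    using that
  proof (induction r)
    case 0
    thus ?case using assms by simp
  next
    case (Suc r)
    define w where "w = fold block_update [0..<r] u"
    have w: "positive w" "\<forall>t<r. \<forall>i<n. i \<notin> set \<pi> \<longrightarrow> w t $ i = 1" using Suc by (simp_all add: w_def)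
    have r: "r \<le> T" using Suc.prems by simp
    have "0 < update_vec r w $ i" if i: "i < n" for i
    proof (cases "i \<in> set \<pi>")
      case True
      then obtain j where "j < k" "i = \<pi> ! j" using length_\<pi> by (metis in_set_conv_nth)
      thus ?thesis using \<rho>_pos[OF r] marg_pos[OF w(1) r] by (simp add: update_vec_observed[OF r])
    qed (simp add: update_vec_unobserved[OF r i])
    hence "positive (block_update r w)" using w(1) update_vec_carrier by (simp add: positive_def block_update_def)
    moreover have "\<forall>t<Suc r. \<forall>i<n. i \<notin> set \<pi> \<longrightarrow> block_update r w t $ i = 1"
      using w(2) update_vec_unobserved[OF r] by (auto simp: block_update_def less_Suc_eq)
    ultimately show ?case by (simp add: w_def)
  qed
  from this[of "Suc T"]
  show "positive (sweep u)" "t \<le> T \<Longrightarrow> i < n \<Longrightarrow> i \<notin> set \<pi> \<Longrightarrow> sweep u t $ i = 1"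
    by (auto simp: sweep_def simp del: upt_Suc)
qed

end

text \<open>A given \<open>u\<close> and the scaling by its logarithms are compared only up to time
  \<open>T\<close>; the messages up to \<open>T\<close> read nothing beyond it.\<close>

lemma sweep_power_cong:
  assumes "\<And>t. t \<le> T \<Longrightarrow> u t = u' t"
  shows "t \<le> T \<Longrightarrow> (sweep ^^ m) u t = (sweep ^^ m) u' t"
proof (induction m arbitrary: t)
  case (Suc m)
  have "\<forall>t\<le>T. fold block_update [0..<r] ((sweep ^^ m) u) t = fold block_update [0..<r] ((sweep ^^ m) u') t" if "r \<le> Suc T" for r
    using that
  proof (induction r)
    case (Suc r)
    define w where "w = fold block_update [0..<r] ((sweep ^^ m) u)"
    define w' where "w' = fold block_update [0..<r] ((sweep ^^ m) u')"
    have "\<forall>t\<le>T. w t = w' t" using Suc by (simp add: w_def w'_def)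
    moreover from this have "pf w r = pf w' r" "ph w r = ph w' r"
      using Suc.prems by (auto intro!: phi_cong phi_hat_cong)
    ultimately have "\<forall>t\<le>T. block_update r w t = block_update r w' t" by (simp add: block_update_def update_vec_def)
    thus ?case by (simp add: w_def w'_def)
  qed (use Suc.IH in simp)
  from this[of "Suc T"] Suc.prems show ?case by (simp add: sweep_def del: upt_Suc)
qed (use assms in simp)

text \<open>A positive start may have unobserved entries other than one, so it is the first sweep
  that yields a scaling. The ascent begins there, which explains the shift from \<open>Suc m\<close>
  sweeps to \<open>m\<close>.\<close>

lemma algorithm_is_ascent:
  assumes ls: "dual_maximizer T A C \<mu> \<rho> ls" and u0: "positive u0"
  shows "\<exists>L. ascent L \<and> (\<forall>m. \<forall>t\<le>T. alg_u T A C Cbar \<mu> \<rho> u0 (Suc m) t = scaling C (L (m * Suc T)) t)"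
proof -
  define u where "u = sweep u0"
  define lam where "lam = restrict (\<lambda>t. vec k (\<lambda>j. ln (u t $ (\<pi> ! j)))) {..T}"
  have lam: "lam \<in> multipliers T k" unfolding lam_def by (rule multipliersI) simp
  have u: "positive u" "\<And>t i. t \<le> T \<Longrightarrow> i < n \<Longrightarrow> i \<notin> set \<pi> \<Longrightarrow> u t $ i = 1"
    unfolding u_def using sweep_positive[OF ls u0] by auto
  have u_lam: "u t = scaling C lam t" if t: "t \<le> T" for t
  proof (rule vec_eq_by_observation[OF _ scaling_carrier])
    show "u t \<in> carrier_vec n" using positive_sized[OF u(1)] t by simp
    show "u t $ (\<pi> ! j) = scaling C lam t $ (\<pi> ! j)" if "j < k" for j
      using that t u(1) multipliersD[OF lam t] by (simp add: scaling_observed lam_def positive_def)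
  qed (use t u(2) multipliersD[OF lam t] in \<open>simp add: scaling_unobserved\<close>)
  obtain L where L: "L 0 = lam" "ascent L" using ascent_exists[OF ls lam] by blast
  have "alg_u T A C Cbar \<mu> \<rho> u0 (Suc m) t = scaling C (L (m * Suc T)) t" if "t \<le> T" for m t
  proof -
    have "alg_u T A C Cbar \<mu> \<rho> u0 (Suc m) t = (sweep ^^ m) u t"
      unfolding alg_u_eq u_def funpow_Suc_right o_apply ..
    also have "\<dots> = (sweep ^^ m) (scaling C (L 0)) t"
      using u_lam that unfolding L(1) by (rule sweep_power_cong)
    finally show ?thesis unfolding sweep_power_scaling[OF L(2)] .
  qed
  thus ?thesis using L by blast
qed

end

text \<open>The update formula and its agreement with the algorithm come first. Convergence is
  stated under the existence of a maximizer, which fails for instance when an observed mass is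
  zero.\<close>

theorem proposition4:
  fixes n T k :: nat
    and \<pi> :: "nat list"
    and A :: "nat \<Rightarrow> real mat"
    and C Cbar :: "real mat"
    and \<rho> :: "nat \<Rightarrow> real vec"
    and \<eta> \<mu> :: "real vec"
  assumes "1 \<le> n" and "1 \<le> T"
    and stochastic: "\<And>t. t < T \<Longrightarrow> row_stochastic n (A t)"
    and "distinct \<pi>" and "set \<pi> \<subseteq> {..<n}" and "length \<pi> = k"
    and C: "C = selection_mat n \<pi>"
    and Cbar: "Cbar = selection_mat n (sorted_list_of_set ({..<n} - set \<pi>))"
    and masses: "\<And>t. t \<le> T \<Longrightarrow> \<rho> t \<in> carrier_vec k \<and> 0\<^sub>v k \<le> \<rho> t"
    and eta: "\<eta> \<in> carrier_vec (n - k)" "0\<^sub>v (n - k) \<le> \<eta>"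
    and mu: "\<mu> = transpose_mat C *\<^sub>v \<rho> 0 + transpose_mat Cbar *\<^sub>v \<eta>"
    and division_defined: "\<And>lam t j. lam \<in> multipliers T k \<Longrightarrow> t \<le> T \<Longrightarrow> j < k \<Longrightarrow>
          (C *\<^sub>v (phi n T A (scaling C lam) t \<odot>\<^sub>v phi_hat A \<mu> (scaling C lam) t)) $ j \<noteq> 0"
  shows
    "(\<forall>lam \<in> multipliers T k. \<forall>t \<le> T. \<forall>x \<in> carrier_vec k.
        let u = scaling C (lam(t := x)) in
        block_maximizer T A C \<mu> \<rho> lam t x \<longleftrightarrow>
          C *\<^sub>v u t = \<rho> t \<oslash>\<^sub>v (C *\<^sub>v (phi n T A u t \<odot>\<^sub>v phi_hat A \<mu> u t)) \<and>
          Cbar *\<^sub>v u t = ones (n - k))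
     \<and>
     (\<forall>L. block_coordinate_ascent T A C \<mu> \<rho> L \<longrightarrow>
        (\<forall>m. \<forall>t \<le> T. alg_u T A C Cbar \<mu> \<rho> (scaling C (L 0)) m t = scaling C (L (m * Suc T)) t))
     \<and>
     ((\<exists>lam. dual_maximizer T A C \<mu> \<rho> lam) \<longrightarrow>
        (\<forall>lam \<in> multipliers T k. \<exists>L. L 0 = lam \<and> block_coordinate_ascent T A C \<mu> \<rho> L) \<and>
        (\<forall>L. block_coordinate_ascent T A C \<mu> \<rho> L \<longrightarrow>
           (\<exists>lam. dual_maximizer T A C \<mu> \<rho> lam \<and> multipliers_converge T k L lam)) \<and>
        (\<forall>u0. (\<forall>t \<le> T. u0 t \<in> carrier_vec n \<and> (\<forall>i<n. 0 < u0 t $ i)) \<longrightarrow>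
           (\<exists>L lam. block_coordinate_ascent T A C \<mu> \<rho> L \<and>
              (\<forall>m. \<forall>t \<le> T. alg_u T A C Cbar \<mu> \<rho> u0 (Suc m) t = scaling C (L (m * Suc T)) t) \<and>
              dual_maximizer T A C \<mu> \<rho> lam \<and> multipliers_converge T k L lam)))"
proof -
  let ?xs = "sorted_list_of_set ({..<n} - set \<pi>)"
  have len: "length ?xs = n - k"
    using assms(4-6) by (simp add: card_Diff_subset distinct_card)
  have A: "A t \<in> carrier_mat n n" if "t < T" for t
    using stochastic[OF that] by (simp add: row_stochastic_def)
  have A_nonneg: "0 \<le> A t $$ (i, j)" if "t < T" "i < n" "j < n" for t i j
  proof -
    have "0\<^sub>m n n \<le> A t" using stochastic[OF that(1)] by (simp add: row_stochastic_def)
    thus ?thesis using A[OF that(1)] that(2,3) unfolding less_eq_mat_def by simp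
  qed
  have \<rho>: "\<rho> t \<in> carrier_vec k" "\<And>j. j < k \<Longrightarrow> 0 \<le> \<rho> t $ j" if "t \<le> T" for t
    using masses[OF that] unfolding less_eq_vec_def by (blast, metis carrier_vecD index_zero_vec(1))
  have \<eta>: "0 \<le> \<eta> $ j" if "j < n - k" for j
    using eta that unfolding less_eq_vec_def by (metis carrier_vecD index_zero_vec(1))
  have \<mu>: "\<mu> \<in> carrier_vec n"
    unfolding mu C Cbar by (intro add_carrier_vec transpose_mult_carrier[OF selection_mat_carrier])
  have \<mu>_nonneg: "0 \<le> \<mu> $ i" if "i < n" for i
  proof -
    have "0 \<le> (transpose_mat C *\<^sub>v \<rho> 0) $ i"
      unfolding C using \<rho>[of 0] assms(6) that
      by (subst selection_mat_transpose_mult_index) (auto intro!: sum_nonneg)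
    moreover have "0 \<le> (transpose_mat Cbar *\<^sub>v \<eta>) $ i"
      unfolding Cbar using eta(1) \<eta> that len
      by (subst selection_mat_transpose_mult_index) (auto intro!: sum_nonneg)
    moreover have "dim_vec (transpose_mat Cbar *\<^sub>v \<eta>) = n" by (simp add: Cbar)
    ultimately show ?thesis using that unfolding mu by simp
  qed
  have phi_dim: "dim_vec (phi n T A u t) = n" if "t \<le> T" for u t
    using A[of t] that by (subst phi.simps) auto
  interpret scaling_problem n T k \<pi> A \<rho> \<mu>
  proof
    fix lam t j assume *: "lam \<in> multipliers T k" "t \<le> T" "j < k"
    have j: "\<pi> ! j < n" using assms(5,6) *(3) nth_mem by fastforce
    let ?u = "scaling (selection_mat n \<pi>) lam"
    \<comment> \<open>Entry \<open>j\<close> of the product with \<open>C\<close> is the entry at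
      state \<open>\<pi> ! j\<close>, which turns the assumption into the coordinate form of the
      locale.\<close>
    have "phi n T A ?u t \<odot>\<^sub>v phi_hat A \<mu> ?u t \<in> carrier_vec n"
      using phi_dim[OF *(2)] by (auto simp: vec_times_def)
    thus "phi n T A ?u t $ (\<pi> ! j) * phi_hat A \<mu> ?u t $ (\<pi> ! j) \<noteq> 0"
      using division_defined[OF *] j *(3) assms(6) phi_dim[OF *(2)]
      by (simp add: C selection_mat_mult_index del: index_mult_mat_vec)
  qed (use A A_nonneg \<rho> \<mu> \<mu>_nonneg assms(4-6) in auto)
  show ?thesis
    unfolding C Cbar
  proof (intro conjI impI ballI allI)
    fix lam t and x :: "real vec" assume "lam \<in> multipliers T k" "t \<le> T" "x \<in> carrier_vec k"
    from block_maximizer_iff_scaling[OF this]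
    show "let u = scaling (selection_mat n \<pi>) (lam(t := x)) in
        block_maximizer T A (selection_mat n \<pi>) \<mu> \<rho> lam t x \<longleftrightarrow>
          selection_mat n \<pi> *\<^sub>v u t =
            \<rho> t \<oslash>\<^sub>v (selection_mat n \<pi> *\<^sub>v (phi n T A u t \<odot>\<^sub>v phi_hat A \<mu> u t)) \<and>
          selection_mat n ?xs *\<^sub>v u t = ones (n - k)"
      by (simp only: Let_def)
  next
    fix L m t assume "block_coordinate_ascent T A (selection_mat n \<pi>) \<mu> \<rho> L"
    thus "alg_u T A (selection_mat n \<pi>) (selection_mat n ?xs) \<mu> \<rho> (scaling (selection_mat n \<pi>) (L 0)) m t =
        scaling (selection_mat n \<pi>) (L (m * Suc T)) t"
      by (simp only: alg_u_eq sweep_power_scaling)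
  next
    fix lam assume "\<exists>lam. dual_maximizer T A (selection_mat n \<pi>) \<mu> \<rho> lam" "lam \<in> multipliers T k"
    thus "\<exists>L. L 0 = lam \<and> block_coordinate_ascent T A (selection_mat n \<pi>) \<mu> \<rho> L"
      using ascent_exists by blast
  next
    fix L assume "\<exists>lam. dual_maximizer T A (selection_mat n \<pi>) \<mu> \<rho> lam"
      "block_coordinate_ascent T A (selection_mat n \<pi>) \<mu> \<rho> L"
    thus "\<exists>lam. dual_maximizer T A (selection_mat n \<pi>) \<mu> \<rho> lam \<and> multipliers_converge T k L lam"
      using ascent_converges by blast
  next
    fix u0 :: "nat \<Rightarrow> real vec"
    assume "\<exists>lam. dual_maximizer T A (selection_mat n \<pi>) \<mu> \<rho> lam"
      and u0: "\<forall>t\<le>T. u0 t \<in> carrier_vec n \<and> (\<forall>i<n. 0 < u0 t $ i)"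
    then obtain ls where ls: "dual_maximizer T A (selection_mat n \<pi>) \<mu> \<rho> ls" by blast
    obtain L where "block_coordinate_ascent T A (selection_mat n \<pi>) \<mu> \<rho> L"
      "\<forall>m. \<forall>t\<le>T. alg_u T A (selection_mat n \<pi>) (selection_mat n ?xs) \<mu> \<rho> u0 (Suc m) t =
        scaling (selection_mat n \<pi>) (L (m * Suc T)) t"
      using algorithm_is_ascent[OF ls] u0 unfolding positive_def by blast
    moreover from ascent_converges[OF ls this(1)]
    obtain lam where "dual_maximizer T A (selection_mat n \<pi>) \<mu> \<rho> lam" "multipliers_converge T k L lam"
      by blast
    ultimately show "\<exists>L lam. block_coordinate_ascent T A (selection_mat n \<pi>) \<mu> \<rho> L \<and>
        (\<forall>m. \<forall>t\<le>T. alg_u T A (selection_mat n \<pi>) (selection_mat n ?xs) \<mu> \<rho> u0 (Suc m) t =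
          scaling (selection_mat n \<pi>) (L (m * Suc T)) t) \<and>
        dual_maximizer T A (selection_mat n \<pi>) \<mu> \<rho> lam \<and> multipliers_converge T k L lam"
      by (intro exI conjI)
  qed
qed

end
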